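(* Let $P$ be the transition matrix of a finite Markov chain on the state space $\mathbb{S}$ with invariant distribution $\mu$ and initial distribution $\mu^{(0)}$, and let $f:\mathbb{S}\to\mathbb{R}^m$. Suppose that (1) $P$ is reversible with spectral gap $g$; (2) $\mathrm{E}f=\sum_s\mu_sf(s)=0$; (3) $\|f\|_\infty\le L$, where $L>0$; and (4) $\sigma^2(f)\le\sigma^2$ for some real number $\sigma^2$. Then for every $\varepsilon>0$ and every integer $N\ge1$, $$\Pr\{|S_N|\ge\varepsilon N\}\le 3\,\|\mu^{(0)}/\mu\|\,2^{m/2}\exp\left[-\alpha\frac{\varepsilon^2}{L^2}N\right],$$ where $$\alpha=\left(4+\frac8g+\frac{1536}{125}\,\frac{g}{\log^2[1+g/2]}\right)^{-1}.$$
   Context: Setting. $\mathbb{S}$ is a finite set with at least two elements, $P=(P_{st})_{s,t\in\mathbb{S}}$ is a stochastic matrix and $\mu$ is its invariant distribution, with $\mu_s>0$ for all $s$. Reversible means $\mu_sP_{st}=\mu_tP_{ts}$ for all $s,t$; then all eigenvalues of $P$ are real, written $\lambda_0=1>\lambda_1\ge\lambda_2\ge\dots\ge\lambda_{|\mathbb{S}|-1}\ge-1$ (so it is assumed that $\lambda_1<1$), and the spectral gap is $g=1-\lambda_1$. $\mathbb{R}^m$ carries its scalar product $\langle\cdot,\cdot\rangle$ and norm $|\cdot|$. $\log$ is the natural logarithm, and $\log^2 x=(\log x)^2$. $\mathrm{E}$ denotes expectation with respect to $\mu$. $\|f\|_\infty=\sup_s|f(s)|$, and the principal variance of $f$ is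 $\sigma^2(f)=\sup_{|u|=1}\sum_s\mu_s\langle f(s),u\rangle^2$. The quantity $\|\mu^{(0)}/\mu\|$ is the nonnegative square root of $\mathrm{E}[(\mu^{(0)}(s)/\mu(s))^2]=\sum_s(\mu^{(0)}_s)^2/\mu_s$. The chain $s_0,s_1,s_2,\dots$ starts with $s_0$ distributed according to $\mu^{(0)}$ (an arbitrary probability distribution on $\mathbb{S}$) and moves with transition matrix $P$; $S_N=\sum_{t=1}^Nf(s_t)$, and $\Pr$ is the law of this chain. *)

theory Defs
  imports "HOL-Probability.Probability" "HOL-Computational_Algebra.Computational_Algebra"
begin

definition stochastic_matrix :: "real ^ 's ^ 's::finite \<Rightarrow> bool" where
  "stochastic_matrix P \<longleftrightarrow> (\<forall>s t. P $ s $ t \<ge> 0) \<and> (\<forall>s. (\<Sum>t\<in>UNIV. P $ s $ t) = 1)"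

definition invariant_distribution :: "real ^ 's ^ 's::finite \<Rightarrow> 's pmf \<Rightarrow> bool" where
  "invariant_distribution P \<mu> \<longleftrightarrow> (\<forall>t. (\<Sum>s\<in>UNIV. pmf \<mu> s * P $ s $ t) = pmf \<mu> t)"

definition reversible :: "real ^ 's ^ 's::finite \<Rightarrow> 's pmf \<Rightarrow> bool" where
  "reversible P \<mu> \<longleftrightarrow> (\<forall>s t. pmf \<mu> s * P $ s $ t = pmf \<mu> t * P $ t $ s)"

definition charpoly :: "real ^ 'n ^ 'n::finite \<Rightarrow> real poly" where
  "charpoly A = det (\<chi> i j. (if i = j then [:0, 1:] else 0) - [:A $ i $ j:])"

text \<open>The real eigenvalues in decreasing order, repeated according to algebraic multiplicity.
  For a stochastic matrix reversible with respect to a positive distribution this is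
  the complete list of eigenvalues; index 0 carries the eigenvalue 1.\<close>

definition eigenvalue_list :: "real ^ 'n ^ 'n::finite \<Rightarrow> real list" where
  "eigenvalue_list A = rev (sorted_list_of_multiset (proots (charpoly A)))"

definition spectral_gap :: "real ^ 'n ^ 'n::finite \<Rightarrow> real" where
  "spectral_gap P = 1 - eigenvalue_list P ! 1"

definition sup_norm :: "('s::finite \<Rightarrow> real ^ 'm::finite) \<Rightarrow> real" where
  "sup_norm f = (SUP s. norm (f s))"

definition principal_variance :: "'s::finite pmf \<Rightarrow> ('s \<Rightarrow> real ^ 'm::finite) \<Rightarrow> real" where
  "principal_variance \<mu> f = (SUP u\<in>{u. norm u = 1}. \<Sum>s\<in>UNIV. pmf \<mu> s * (f s \<bullet> u)\<^sup>2)"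

definition density_norm :: "'s::finite pmf \<Rightarrow> 's pmf \<Rightarrow> real" where
  "density_norm \<mu>0 \<mu> = sqrt (measure_pmf.expectation \<mu> (\<lambda>s. (pmf \<mu>0 s / pmf \<mu> s)\<^sup>2))"

text \<open>The Markov property is stated in multiplied-out form, so that no conditioning on null
  events occurs.\<close>

definition markov_chain ::
  "'w measure \<Rightarrow> (nat \<Rightarrow> 'w \<Rightarrow> 's) \<Rightarrow> real ^ 's ^ 's::finite \<Rightarrow> 's pmf \<Rightarrow> bool" where
  "markov_chain M X P \<mu>0 \<longleftrightarrow>
     prob_space M \<and>
     (\<forall>t. X t \<in> measurable M (count_space UNIV)) \<and>
     (\<forall>x. measure M {\<omega>\<in>space M. X 0 \<omega> = x} = pmf \<mu>0 x) \<and>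
     (\<forall>n x. measure M {\<omega>\<in>space M. \<forall>t\<le>Suc n. X t \<omega> = x t} =
              measure M {\<omega>\<in>space M. \<forall>t\<le>n. X t \<omega> = x t} * P $ x n $ x (Suc n))"

end

(*
  By Cauchy-Schwarz in L^2(mu), the exponential moment E exp <u, S_N> is at most ||mu0/mu|| times
  the norm of (P D)^N 1, where D is multiplication by exp <u, f>. The operator P D is similar to the
  symmetric operator D^{1/2} P D^{1/2}. With b = L |u| and g' = min g 1, expanding the exponentials to
  second order and using that P contracts mean-zero functions shows that its norm is at most
  exp (3 b^2 / g'). Hence E exp <u, S_N> <= 3 ||mu0/mu|| exp (K |u|^2) with K proportional to N.
  Averaging over a Gaussian vector u bounds E exp (|S_N|^2 / (8 K)) by
  3 ||mu0/mu|| 2^{m/2}, and Markov's inequality gives the tail bound. The constant alpha leaves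
  ample room, so no sharp perturbation theory of eigenvalues is needed.
*)

theory Submission
  imports Defs
begin

unbundle no Formal_Power_Series.fps_syntax

section \<open>Eigenvectors and the characteristic polynomial\<close>

text \<open>\<open>spectral_gap\<close> reads the second entry of a sorted list of roots of a
  characteristic polynomial, while the estimates need an inequality between quadratic forms. The
  bridge is variational: the maximum \<beta> of the form of \<open>P\<close> over mean-zero unit
  functions is attained at an eigenvector; together with the constant eigenvector it yields two
  linear factors of the polynomial, so \<beta> is at most the second root. Eigenvalues near -1 are
  not controlled by the gap. They do no harm because the symmetrized tilted operator has nonnegative
  entries, so an upper bound on its form is a bound on its norm. The cap g' = min g 1 is there
  because 1 - g' multiplies upper bounds and must not be negative.\<close>

lemma poly_charpoly:
  "poly (charpoly A) x = det (\<chi> i j. (if i = j then x else 0) - A $ i $ j)"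
  unfolding charpoly_def det_def
  by (simp add: poly_sum poly_prod of_int_poly if_distrib[of "\<lambda>p. poly p x"] cong: if_cong)

definition const_mat :: "real ^ 'n ^ 'm \<Rightarrow> real poly ^ 'n ^ 'm" where
  "const_mat A = (\<chi> i j. [:A $ i $ j:])"

lemma pCons_0_sum: "[:sum f S:] = (\<Sum>i\<in>S. [:f i:])"
proof (induction S rule: infinite_finite_induct)
  case (insert x F)
  have "[:sum f (insert x F):] = [:f x:] + [:sum f F:]" using insert.hyps by simp
  thus ?case using insert by simp
qed auto

text \<open>Constant polynomials respect products, so a real inverse of \<open>Q\<close> is also an
  inverse over the polynomial ring; this makes \<open>det (const_mat Q)\<close> a unit.\<close>

lemma const_mat_mult: "const_mat (A ** B) = const_mat A ** const_mat B"
  by (simp add: const_mat_def matrix_matrix_mult_def vec_eq_iff pCons_0_sum mult.commute)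

lemma const_mat_1: "const_mat (mat 1) = mat 1"
  by (simp add: const_mat_def mat_def vec_eq_iff)

text \<open>With \<open>Q\<close> the identity matrix whose columns \<open>i\<close>, \<open>j\<close> are replaced by the eigenvectors, the same
  columns of \<open>(x I - A) Q\<close> carry the factors \<open>x - a\<close> and \<open>x - b\<close>, and \<open>det Q\<close> is a unit. This also
  covers \<open>a = b\<close>, where a double root is needed.\<close>

lemma linear_factors_dvd_charpoly:
  fixes A :: "real ^ 'n ^ 'n::finite"
  assumes v: "A *v v = a *s v" and w: "A *v w = b *s w"
    and vw: "v $ i * w $ j \<noteq> v $ j * w $ i"
  shows "[:-a, 1:] * [:-b, 1:] dvd charpoly A"
proof -
  have ij: "i \<noteq> j" using vw by auto
  define Q where "Q = (\<chi> r c. if c = i then v $ r else if c = j then w $ r else if r = c then 1 else (0 :: real))"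
  have Qx: "(Q *v x) $ r = v $ r * x $ i + w $ r * x $ j + (if r \<in> {i, j} then 0 else x $ r)" for x r
  proof -
    have "(Q *v x) $ r = (\<Sum>c\<in>UNIV. (if c = i then v $ r * x $ i else 0)
        + (if c = j then w $ r * x $ j else 0) + (if c = r then if r \<in> {i, j} then 0 else x $ r else 0))"
      unfolding Q_def matrix_vector_mult_def using ij by (auto intro!: sum.cong)
    also have "\<dots> = v $ r * x $ i + w $ r * x $ j + (if r \<in> {i, j} then 0 else x $ r)"
      unfolding sum.distrib by simp
    finally show ?thesis .
  qed
  have "x = 0" if "Q *v x = 0" for x
  proof -
    have e: "v $ r * x $ i + w $ r * x $ j + (if r \<in> {i, j} then 0 else x $ r) = 0" for r
      using Qx[of x r] that by simp
    have e1: "v $ i * x $ i + w $ i * x $ j = 0" and e2: "v $ j * x $ i + w $ j * x $ j = 0"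
      using e[of i] e[of j] by auto
    \<comment> \<open>Cramer's rule for rows \<open>i\<close> and \<open>j\<close>, whose
      determinant is the minor that \<open>vw\<close> makes nonzero.\<close>
    have "(v $ i * w $ j - v $ j * w $ i) * x $ i = 0" "(v $ i * w $ j - v $ j * w $ i) * x $ j = 0"
      using e1 e2 by algebra+
    hence "x $ i = 0" "x $ j = 0" using vw by auto
    hence "x $ r = 0" for r using e[of r] by (auto split: if_splits)
    thus ?thesis by (simp add: vec_eq_iff)
  qed
  then obtain B where B: "B ** Q = mat 1"
    using matrix_left_invertible_ker[of Q] by blast
  hence "const_mat B ** const_mat Q = mat 1"
    by (metis const_mat_mult const_mat_1)
  hence unit: "det (const_mat B) * det (const_mat Q) = 1"
    by (metis det_mul det_I)
  define C where "C = (\<chi> i j. (if i = j then [:0, 1:] else 0) - [:A $ i $ j:])"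
  define R where "R = C ** const_mat Q"
  \<comment> \<open>Transposing turns columns into rows, where \<open>det_row_mul\<close> applies.
    \<open>R1\<close> is \<open>transpose R\<close> with the factor \<open>x - a\<close> taken out
    of row \<open>i\<close>; \<open>R2\<close> also loses \<open>x - b\<close> from row
    \<open>j\<close>.\<close>
  define R1 where "R1 = (\<chi> c r. if c = i then [:v $ r:] else transpose R $ c $ r)"
  define R2 where "R2 = (\<chi> c r. if c = j then [:w $ r:] else R1 $ c $ r)"
  have eig: "(\<Sum>k\<in>UNIV. C $ r $ k * [:u $ k:]) = [:-c, 1:] * [:u $ r:]"
    if u: "A *v u = c *s u" for u c r
  proof -
    have "(\<Sum>k\<in>UNIV. C $ r $ k * [:u $ k:])
        = (\<Sum>k\<in>UNIV. (if r = k then [:0, u $ r:] else 0)) - (\<Sum>k\<in>UNIV. [:A $ r $ k * u $ k:])"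
      unfolding C_def sum_subtractf[symmetric] by (intro sum.cong) (auto simp: algebra_simps)
    also have "\<dots> = [:0, u $ r:] - [:(A *v u) $ r:]"
      by (simp add: pCons_0_sum matrix_vector_mult_def)
    also have "\<dots> = [:-c, 1:] * [:u $ r:]" by (simp add: u)
    finally show ?thesis .
  qed
  have Ri: "R $ r $ i = [:-a, 1:] * [:v $ r:]" for r
    using eig[OF v, of r] by (simp add: R_def matrix_matrix_mult_def const_mat_def Q_def)
  have Rj: "R $ r $ j = [:-b, 1:] * [:w $ r:]" for r
    using eig[OF w, of r] ij by (simp add: R_def matrix_matrix_mult_def const_mat_def Q_def)
  have "det (transpose R) = det (\<chi> k. if k = i then [:-a, 1:] *s R1 $ k else transpose R $ k)"
    by (rule arg_cong[of _ _ det]) (auto simp: vec_eq_iff R1_def transpose_def Ri)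
  also have "\<dots> = [:-a, 1:] * det (\<chi> k. if k = i then R1 $ k else transpose R $ k)"
    by (rule det_row_mul)
  also have "(\<chi> k. if k = i then R1 $ k else transpose R $ k) = R1"
    by (auto simp: vec_eq_iff R1_def)
  also have "det R1 = det (\<chi> k. if k = j then [:-b, 1:] *s R2 $ k else R1 $ k)"
    using ij by (intro arg_cong[of _ _ det]) (auto simp: vec_eq_iff R1_def R2_def transpose_def Rj)
  also have "\<dots> = [:-b, 1:] * det (\<chi> k. if k = j then R2 $ k else R1 $ k)"
    by (rule det_row_mul)
  also have "det (transpose R) = charpoly A * det (const_mat Q)"
    by (simp add: det_transpose R_def det_mul C_def charpoly_def)
  finally have "charpoly A * det (const_mat Q)
      = [:-a, 1:] * ([:-b, 1:] * det (\<chi> k. if k = j then R2 $ k else R1 $ k))" .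
  from arg_cong[OF this, of "\<lambda>z. z * det (const_mat B)"]
  have "charpoly A * (det (const_mat B) * det (const_mat Q))
      = [:-a, 1:] * [:-b, 1:] * (det (\<chi> k. if k = j then R2 $ k else R1 $ k) * det (const_mat B))"
    by (simp only: mult_ac)
  thus ?thesis unfolding unit by (simp only: mult_1_right dvd_triv_left)
qed

text \<open>If the second entry were below \<open>b\<close>, neither \<open>a\<close> nor
  \<open>b\<close> could occur from there on, and both would have to be the single head. Counting
  with multiplicity covers \<open>a = b\<close>.\<close>

lemma second_of_sorted_ge:
  fixes a b :: "'a::linorder"
  assumes "{#a, b#} \<subseteq># M" "b \<le> a"
  shows "b \<le> rev (sorted_list_of_multiset M) ! 1"
proof -
  define l where "l = rev (sorted_list_of_multiset M)"
  have ml: "mset l = M" by (simp add: l_def)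
  have srt: "sorted_wrt (\<lambda>x y. y \<le> x) l" by (simp add: l_def sorted_wrt_rev)
  have "2 \<le> length l" using size_mset_mono[OF assms(1)] by (simp flip: ml)
  then obtain x y r where l: "l = x # y # r"
    by (cases l; cases "tl l") auto
  have "b \<le> y"
  proof (rule ccontr)
    assume "\<not> b \<le> y"
    moreover have "\<forall>z\<in>set r. z \<le> y" using srt l by auto
    ultimately have "a \<notin># mset (y # r)" "b \<notin># mset (y # r)" using assms(2) by auto
    moreover have "{#a, b#} \<subseteq># add_mset x (mset (y # r))" using assms(1) ml l by simp
    ultimately show False
      by (auto simp: insert_subset_eq_iff)
  qed
  thus ?thesis using l by (simp add: l_def)
qed

lemma eigenvalue_list_second_ge:
  fixes A :: "real ^ 'n ^ 'n::finite"
  assumes "A *v v = a *s v" "A *v w = b *s w" "v $ i * w $ j \<noteq> v $ j * w $ i"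
    and "b \<le> a" and nz: "charpoly A \<noteq> 0"
  shows "b \<le> eigenvalue_list A ! 1"
proof -
  obtain q where q: "charpoly A = [:-a, 1:] * [:-b, 1:] * q"
    using linear_factors_dvd_charpoly[OF assms(1-3)] by (auto simp: dvd_def)
  hence "q \<noteq> 0" using nz by auto
  hence "proots (charpoly A) = {#a, b#} + proots q"
    unfolding q by (subst proots_mult, simp, simp, subst proots_mult) auto
  thus ?thesis unfolding eigenvalue_list_def
    by (intro second_of_sorted_ge[of a] assms) simp
qed

section \<open>The spectral gap of a reversible chain\<close>

locale reversible_chain =
  fixes P :: "real ^ 's ^ 's::finite" and \<mu> :: "'s pmf"
  assumes stoch: "stochastic_matrix P"
    and rev: "reversible P \<mu>"
    and pos: "\<And>s. pmf \<mu> s > 0"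
begin

definition ip :: "('s \<Rightarrow> real) \<Rightarrow> ('s \<Rightarrow> real) \<Rightarrow> real" where
  "ip \<phi> \<psi> = (\<Sum>s\<in>UNIV. pmf \<mu> s * (\<phi> s * \<psi> s))"

definition Pop :: "('s \<Rightarrow> real) \<Rightarrow> 's \<Rightarrow> real" where
  "Pop \<phi> s = (\<Sum>t\<in>UNIV. P $ s $ t * \<phi> t)"

lemma P_nonneg: "P $ s $ t \<ge> 0" and P_sum: "(\<Sum>t\<in>UNIV. P $ s $ t) = 1"
  using stoch by (auto simp: stochastic_matrix_def)

lemma ip_commute: "ip \<phi> \<psi> = ip \<psi> \<phi>"
  by (simp add: ip_def mult.commute)

lemma ip_add_left: "ip (\<lambda>s. \<phi> s + \<phi>' s) \<psi> = ip \<phi> \<psi> + ip \<phi>' \<psi>"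
  by (simp add: ip_def algebra_simps sum.distrib)

lemma ip_diff_left: "ip (\<lambda>s. \<phi> s - \<phi>' s) \<psi> = ip \<phi> \<psi> - ip \<phi>' \<psi>"
  by (simp add: ip_def algebra_simps sum_subtractf)

lemma ip_scale_left: "ip (\<lambda>s. c * \<phi> s) \<psi> = c * ip \<phi> \<psi>"
  by (simp add: ip_def sum_distrib_left mult_ac)

lemma ip_add_right: "ip \<psi> (\<lambda>s. \<phi> s + \<phi>' s) = ip \<psi> \<phi> + ip \<psi> \<phi>'"
  and ip_diff_right: "ip \<psi> (\<lambda>s. \<phi> s - \<phi>' s) = ip \<psi> \<phi> - ip \<psi> \<phi>'"
  and ip_scale_right: "ip \<psi> (\<lambda>s. c * \<phi> s) = c * ip \<psi> \<phi>"
  by (simp_all only: ip_commute[of \<psi>] ip_add_left ip_diff_left ip_scale_left)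

lemmas ip_simps = ip_add_left ip_diff_left ip_scale_left ip_add_right ip_diff_right ip_scale_right

lemma ip_nonneg: "ip \<phi> \<phi> \<ge> 0"
  by (auto simp: ip_def intro!: sum_nonneg)

lemma ip_eq_0_iff: "ip \<phi> \<phi> = 0 \<longleftrightarrow> (\<forall>s. \<phi> s = 0)"
  unfolding ip_def by (subst sum_nonneg_eq_0_iff) (auto simp: order_less_imp_not_eq2[OF pos])

lemma ip_mono: "(\<And>s. \<phi> s * \<psi> s \<le> \<phi>' s * \<psi>' s) \<Longrightarrow> ip \<phi> \<psi> \<le> ip \<phi>' \<psi>'"
  by (auto simp: ip_def intro!: sum_mono mult_left_mono)

lemma ip_1_1: "ip (\<lambda>_. 1) (\<lambda>_. 1) = 1"
  using sum_pmf_eq_1[of UNIV \<mu>] by (simp add: ip_def)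

lemma ip_Cauchy_Schwarz: "(ip \<phi> \<psi>)\<^sup>2 \<le> ip \<phi> \<phi> * ip \<psi> \<psi>"
proof -
  have "(\<Sum>s\<in>UNIV. (sqrt (pmf \<mu> s) * \<phi> s) * (sqrt (pmf \<mu> s) * \<psi> s))\<^sup>2
      \<le> (\<Sum>s\<in>UNIV. (sqrt (pmf \<mu> s) * \<phi> s)\<^sup>2) * (\<Sum>s\<in>UNIV. (sqrt (pmf \<mu> s) * \<psi> s)\<^sup>2)"
    by (rule Cauchy_Schwarz_ineq_sum)
  moreover have "(sqrt (pmf \<mu> s) * \<phi> s) * (sqrt (pmf \<mu> s) * \<psi> s) = pmf \<mu> s * (\<phi> s * \<psi> s)" for s \<phi> \<psi>
  proof -
    have "(sqrt (pmf \<mu> s) * \<phi> s) * (sqrt (pmf \<mu> s) * \<psi> s)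
        = (sqrt (pmf \<mu> s) * sqrt (pmf \<mu> s)) * (\<phi> s * \<psi> s)" by (simp only: mult_ac)
    thus ?thesis by simp
  qed
  ultimately show ?thesis by (simp add: ip_def power2_eq_square)
qed

lemma ip_Cauchy_Schwarz_abs: "\<bar>ip \<phi> \<psi>\<bar> \<le> sqrt (ip \<phi> \<phi>) * sqrt (ip \<psi> \<psi>)"
  using real_sqrt_le_mono[OF ip_Cauchy_Schwarz, of \<phi> \<psi>] by (simp add: real_sqrt_mult)

text \<open>Cauchy-Schwarz, with the L^2 norm of \<open>h\<close> at most its supremum because \<mu>
  has mass 1.\<close>

lemma ip_bounded_le:
  assumes "\<And>s. \<bar>h s\<bar> \<le> b" "b \<ge> 0"
  shows "\<bar>ip h \<phi>\<bar> \<le> b * sqrt (ip \<phi> \<phi>)"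
proof -
  have "ip h h \<le> ip (\<lambda>s. b * 1) (\<lambda>s. b * 1)"
  proof (rule ip_mono)
    fix s show "h s * h s \<le> b * 1 * (b * 1)"
      using abs_le_square_iff[of "h s" b] assms by (simp add: power2_eq_square)
  qed
  also have "\<dots> = b\<^sup>2" unfolding ip_simps ip_1_1 by (simp add: power2_eq_square)
  finally have "sqrt (ip h h) \<le> b" using assms(2) by (simp add: real_le_lsqrt)
  thus ?thesis using ip_Cauchy_Schwarz_abs[of h \<phi>]
    by (meson mult_right_mono order_trans real_sqrt_ge_zero ip_nonneg)
qed

lemma Pop_add: "Pop (\<lambda>s. \<phi> s + \<psi> s) = (\<lambda>s. Pop \<phi> s + Pop \<psi> s)"
  and Pop_diff: "Pop (\<lambda>s. \<phi> s - \<psi> s) = (\<lambda>s. Pop \<phi> s - Pop \<psi> s)"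
  and Pop_scale: "Pop (\<lambda>s. c * \<phi> s) = (\<lambda>s. c * Pop \<phi> s)"
  by (simp_all add: Pop_def fun_eq_iff algebra_simps sum.distrib sum_subtractf sum_distrib_left)

lemma Pop_1: "Pop (\<lambda>_. 1) = (\<lambda>_. 1)"
  by (simp add: Pop_def fun_eq_iff P_sum)

lemma ip_Pop: "ip \<phi> (Pop \<psi>) = (\<Sum>s\<in>UNIV. \<Sum>t\<in>UNIV. pmf \<mu> s * P $ s $ t * (\<phi> s * \<psi> t))"
  by (simp add: ip_def Pop_def sum_distrib_left mult_ac)

lemma Pop_selfadjoint: "ip \<phi> (Pop \<psi>) = ip (Pop \<phi>) \<psi>"
proof -
  have "ip \<phi> (Pop \<psi>) = (\<Sum>s\<in>UNIV. \<Sum>t\<in>UNIV. pmf \<mu> t * P $ t $ s * (\<phi> s * \<psi> t))"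
    using rev by (simp add: ip_Pop reversible_def)
  also have "\<dots> = ip \<psi> (Pop \<phi>)"
    by (subst sum.swap) (simp add: ip_Pop mult_ac)
  finally show ?thesis by (simp add: ip_commute)
qed

text \<open>Both marginals of the weights \<open>pmf \<mu> s * P $ s $ t\<close> are \<mu>: the
  first by row sums, the second by reversibility.\<close>

lemma double_sum_square:
  "(\<Sum>s\<in>UNIV. \<Sum>t\<in>UNIV. pmf \<mu> s * P $ s $ t * (\<phi> s)\<^sup>2) = ip \<phi> \<phi>"
  "(\<Sum>s\<in>UNIV. \<Sum>t\<in>UNIV. pmf \<mu> s * P $ s $ t * (\<phi> t)\<^sup>2) = ip \<phi> \<phi>"
proof -
  show 1: "(\<Sum>s\<in>UNIV. \<Sum>t\<in>UNIV. pmf \<mu> s * P $ s $ t * (\<phi> s)\<^sup>2) = ip \<phi> \<phi>" for \<phi>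
    by (simp add: ip_def P_sum power2_eq_square flip: sum_distrib_left sum_distrib_right)
  have "(\<Sum>s\<in>UNIV. \<Sum>t\<in>UNIV. pmf \<mu> s * P $ s $ t * (\<phi> t)\<^sup>2)
      = (\<Sum>s\<in>UNIV. \<Sum>t\<in>UNIV. pmf \<mu> t * P $ t $ s * (\<phi> t)\<^sup>2)"
    using rev by (simp add: reversible_def)
  also have "\<dots> = ip \<phi> \<phi>" by (subst sum.swap) (rule 1)
  finally show "(\<Sum>s\<in>UNIV. \<Sum>t\<in>UNIV. pmf \<mu> s * P $ s $ t * (\<phi> t)\<^sup>2) = ip \<phi> \<phi>" .
qed

text \<open>Averaging the squares of \<open>\<phi> s + \<phi> t\<close> and of
  \<open>\<phi> s - \<phi> t\<close> over one stationary step gives the two signs.\<close>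

lemma Pop_abs_le: "\<bar>ip \<phi> (Pop \<phi>)\<bar> \<le> ip \<phi> \<phi>"
proof -
  have "0 \<le> ip \<phi> \<phi> + c\<^sup>2 * ip \<phi> \<phi> + 2 * c * ip \<phi> (Pop \<phi>)" for c
  proof -
    have "0 \<le> (\<Sum>s\<in>UNIV. \<Sum>t\<in>UNIV. pmf \<mu> s * P $ s $ t * (\<phi> s + c * \<phi> t)\<^sup>2)"
      by (intro sum_nonneg mult_nonneg_nonneg P_nonneg) auto
    also have "\<dots> = (\<Sum>s\<in>UNIV. \<Sum>t\<in>UNIV. pmf \<mu> s * P $ s $ t * (\<phi> s)\<^sup>2
        + c\<^sup>2 * (pmf \<mu> s * P $ s $ t * (\<phi> t)\<^sup>2) + 2 * c * (pmf \<mu> s * P $ s $ t * (\<phi> s * \<phi> t)))"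
      by (intro sum.cong refl) (simp add: power2_eq_square algebra_simps)
    also have "\<dots> = ip \<phi> \<phi> + c\<^sup>2 * ip \<phi> \<phi> + 2 * c * ip \<phi> (Pop \<phi>)"
      unfolding sum.distrib sum_distrib_left[symmetric] double_sum_square ip_Pop ..
    finally show ?thesis .
  qed
  from this[of 1] this[of "-1"] show ?thesis by simp
qed

lemma Pop_eq_matrix: "(P *v v) $ s = Pop (($) v) s"
  by (simp add: Pop_def matrix_vector_mult_def)

text \<open>A zero polynomial would vanish at 2 and make 2 an eigenvalue, contradicting that the
  form of \<open>P\<close> is at most the squared norm.\<close>

lemma charpoly_nonzero: "charpoly P \<noteq> 0"
proof
  assume "charpoly P = 0"
  hence "\<not> invertible (\<chi> i j. (if i = j then 2 else 0) - P $ i $ j)"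
    using poly_charpoly[of P 2] by (simp add: invertible_det_nz)
  then obtain x where x: "x \<noteq> 0" "(\<chi> i j. (if i = j then 2 else 0) - P $ i $ j) *v x = 0"
    by (auto simp: invertible_left_inverse matrix_left_invertible_ker)
  have "2 * x $ s = Pop (($) x) s" for s
  proof -
    have "0 = (\<Sum>j\<in>UNIV. ((if s = j then 2 else 0) - P $ s $ j) * x $ j)"
      using x(2) by (auto simp: vec_eq_iff matrix_vector_mult_def)
    also have "\<dots> = (\<Sum>j\<in>UNIV. if s = j then 2 * x $ j else 0) - Pop (($) x) s"
      unfolding Pop_def sum_subtractf[symmetric] by (intro sum.cong) (auto simp: algebra_simps)
    finally show ?thesis by simp
  qed
  hence "Pop (($) x) = (\<lambda>s. 2 * x $ s)" by (simp add: fun_eq_iff)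
  hence "2 * ip (($) x) (($) x) \<le> ip (($) x) (($) x)"
    using Pop_abs_le[of "($) x"] by (simp add: ip_scale_right)
  hence "ip (($) x) (($) x) = 0" using ip_nonneg[of "($) x"] by simp
  thus False using x(1) by (auto simp: ip_eq_0_iff vec_eq_iff)
qed

lemma continuous_on_ip:
  assumes "\<And>s. continuous_on A (\<lambda>v. F v s)" "\<And>s. continuous_on A (\<lambda>v. G v s)"
  shows "continuous_on A (\<lambda>v. ip (F v) (G v))"
  unfolding ip_def by (intro continuous_intros assms)

text \<open>A maximizer of the form on the compact set \<open>K\<close> of mean-zero unit functions
  is an eigenvector, so its value \<beta> is at most the second root. Splitting off the mean then
  extends the estimate to all functions, and \<beta> >= -1 bounds the gap by 2.\<close>

lemma spectral_gap_form:
  assumes card: "CARD('s) \<ge> 2"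
  shows "spectral_gap P \<le> 2"
    and "ip \<phi> (Pop \<phi>) \<le> (1 - spectral_gap P) * ip \<phi> \<phi> + spectral_gap P * (ip (\<lambda>_. 1) \<phi>)\<^sup>2"
proof -
  let ?one = "\<lambda>_::'s. 1 :: real"
  define K where "K = {v :: real ^ 's. ip (($) v) (($) v) = 1 \<and> ip ?one (($) v) = 0}"
  have cont: "continuous_on A (\<lambda>v. ip (($) v) (($) v))" "continuous_on A (\<lambda>v. ip ?one (($) v))"
    "continuous_on A (\<lambda>v. ip (($) v) (Pop (($) v)))" for A
    unfolding Pop_def by (intro continuous_on_ip continuous_intros)+
  have "closed K" unfolding K_def Collect_conj_eq
    by (intro closed_Int closed_Collect_eq cont continuous_intros)
  moreover have "bounded K"
  proof -
    have "\<bar>v $ s\<bar> \<le> 1 / sqrt (pmf \<mu> s)" if "v \<in> K" for v s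
    proof -
      have "pmf \<mu> s * (v $ s * v $ s) \<le> ip (($) v) (($) v)"
        unfolding ip_def by (rule member_le_sum) auto
      hence "(v $ s)\<^sup>2 \<le> 1 / pmf \<mu> s"
        using that pos[of s] by (simp add: K_def field_simps power2_eq_square)
      hence "sqrt ((v $ s)\<^sup>2) \<le> sqrt (1 / pmf \<mu> s)" by (rule real_sqrt_le_mono)
      thus ?thesis by (simp add: real_sqrt_divide)
    qed
    hence "norm v \<le> (\<Sum>s\<in>UNIV. 1 / sqrt (pmf \<mu> s))" if "v \<in> K" for v
      using that by (intro order_trans[OF norm_le_l1_cart] sum_mono)
    thus ?thesis by (rule boundedI)
  qed
  ultimately have "compact K" by (simp add: compact_eq_bounded_closed)
  have normalize: "(\<chi> s. \<phi> s / sqrt (ip \<phi> \<phi>)) \<in> K" if "ip ?one \<phi> = 0" "ip \<phi> \<phi> \<noteq> 0" for \<phi>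
  proof -
    have p: "ip \<phi> \<phi> > 0" using that(2) ip_nonneg[of \<phi>] by linarith
    define c where "c = 1 / sqrt (ip \<phi> \<phi>)"
    have c: "c * (c * ip \<phi> \<phi>) = 1" using p by (simp add: c_def field_simps)
    have e: "($) (\<chi> s. \<phi> s / sqrt (ip \<phi> \<phi>)) = (\<lambda>s. c * \<phi> s)" by (simp add: fun_eq_iff c_def)
    show ?thesis unfolding K_def mem_Collect_eq e ip_scale_left ip_scale_right c that by simp
  qed
  obtain s0 s1 :: 's where s01: "s0 \<noteq> s1"
  proof -
    have "\<not> CARD('s) \<le> Suc 0" using card by linarith
    hence "\<exists>a b :: 's. a \<noteq> b" by (subst (asm) card_le_Suc0_iff_eq) simp_all
    thus ?thesis using that by blast
  qed
  have "K \<noteq> {}"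
  proof -
    \<comment> \<open>Dividing by the weights makes the two point masses cancel in the mean; this
      needs two distinct states.\<close>
    define \<phi> where "\<phi> = (\<lambda>s. if s = s0 then 1 / pmf \<mu> s0 else if s = s1 then - 1 / pmf \<mu> s1 else 0)"
    have "ip ?one \<phi> = (\<Sum>s\<in>UNIV. (if s = s0 then 1 else 0) - (if s = s1 then 1 else 0))"
      unfolding ip_def \<phi>_def using s01 pos by (intro sum.cong) (auto simp: less_imp_neq[symmetric])
    hence "ip ?one \<phi> = 0" by (simp add: sum_subtractf)
    moreover have "ip \<phi> \<phi> \<noteq> 0"
      unfolding ip_eq_0_iff using pos[of s0] by (auto simp: \<phi>_def intro!: exI[of _ s0])
    ultimately show ?thesis using normalize by blast
  qed
  obtain w where w: "w \<in> K"
    and wmax: "\<And>v. v \<in> K \<Longrightarrow> ip (($) v) (Pop (($) v)) \<le> ip (($) w) (Pop (($) w))"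
    using continuous_attains_sup[OF \<open>compact K\<close> \<open>K \<noteq> {}\<close> cont(3)] by blast
  define W where "W = ($) w"
  define \<beta> where "\<beta> = ip W (Pop W)"
  have WW: "ip W W = 1" and W1: "ip ?one W = 0" using w by (auto simp: K_def W_def)
  have quad: "ip \<phi> (Pop \<phi>) \<le> \<beta> * ip \<phi> \<phi>" if z: "ip ?one \<phi> = 0" for \<phi>
  proof (cases "ip \<phi> \<phi> = 0")
    case True
    thus ?thesis using Pop_abs_le[of \<phi>] by simp
  next
    case False
    define c where "c = 1 / sqrt (ip \<phi> \<phi>)"
    have p: "ip \<phi> \<phi> > 0" using False ip_nonneg[of \<phi>] by linarith
    have c: "c * c * ip \<phi> \<phi> = 1" "c > 0" using p by (simp_all add: c_def field_simps)
    have e: "($) (\<chi> s. \<phi> s / sqrt (ip \<phi> \<phi>)) = (\<lambda>s. c * \<phi> s)" by (simp add: fun_eq_iff c_def)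
    have "ip (\<lambda>s. c * \<phi> s) (Pop (\<lambda>s. c * \<phi> s)) \<le> \<beta>"
      using wmax[OF normalize[OF z False]] unfolding e \<beta>_def W_def .
    hence "c * c * ip \<phi> (Pop \<phi>) \<le> \<beta> * (c * c * ip \<phi> \<phi>)"
      unfolding Pop_scale ip_simps c by (simp add: mult_ac)
    hence "c * c * ip \<phi> (Pop \<phi>) \<le> c * c * (\<beta> * ip \<phi> \<phi>)" by (simp add: mult_ac)
    thus ?thesis by (rule mult_left_le_imp_le) (use c(2) in simp)
  qed
  \<comment> \<open>The form \<open>\<beta> \<langle>\<phi>, \<phi>\<rangle> - \<langle>\<phi>, P \<phi>\<rangle>\<close> is positive semidefinite on mean-zero functions and vanishes at \<open>W\<close>;
    its first variation at \<open>W\<close> in the mean-zero direction \<open>\<beta> W - P W\<close> must therefore vanish.\<close>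
  have eigen: "Pop W = (\<lambda>s. \<beta> * W s)"
  proof -
    define D where "D = (\<lambda>s. \<beta> * W s - Pop W s)"
    have D1: "ip ?one D = 0"
      unfolding D_def ip_simps Pop_selfadjoint Pop_1 W1 by simp
    have "2 * t * ip D D + t\<^sup>2 * (\<beta> * ip D D - ip D (Pop D)) \<ge> 0" for t
    proof -
      have "ip ?one (\<lambda>s. W s + t * D s) = 0" by (simp add: ip_simps W1 D1)
      from quad[OF this]
      have "0 \<le> \<beta> * (1 + 2 * t * ip W D + t\<^sup>2 * ip D D)
          - (\<beta> + 2 * t * ip (Pop W) D + t\<^sup>2 * ip D (Pop D))"
        by (simp add: Pop_add Pop_scale ip_simps WW ip_commute[of D W] Pop_selfadjoint[of W D] ip_commute[of D "Pop W"]
            algebra_simps power2_eq_square flip: \<beta>_def)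
      also have "\<dots> = 2 * t * ip D D + t\<^sup>2 * (\<beta> * ip D D - ip D (Pop D))"
        unfolding D_def by (simp add: ip_simps algebra_simps)
      finally show ?thesis .
    qed
    note D = this
    have "ip D D = 0"
    proof (rule ccontr)
      define x y where "x = ip D D" and "y = \<bar>\<beta> * ip D D - ip D (Pop D)\<bar> + 1"
      assume "ip D D \<noteq> 0"
      hence x: "x > 0" using ip_nonneg[of D] by (simp add: x_def)
      have y: "y > 0" by (simp add: y_def)
      \<comment> \<open>At \<open>t = - x / y\<close> the linear term is -2 x^2 / y and the
        quadratic one at most x^2 / y. The \<open>+ 1\<close> in \<open>y\<close> only keeps the
        denominator positive.\<close>
      have "0 \<le> 2 * (- x / y) * x + (- x / y)\<^sup>2 * (\<beta> * ip D D - ip D (Pop D))"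
        using D[of "- x / y"] by (simp add: x_def)
      also have "\<dots> \<le> 2 * (- x / y) * x + (- x / y)\<^sup>2 * y"
        by (intro add_left_mono mult_left_mono) (auto simp: y_def)
      also have "\<dots> = - (x\<^sup>2 / y)" using y by (simp add: field_simps power2_eq_square)
      also have "\<dots> < 0" using x y by simp
      finally show False by simp
    qed
    thus ?thesis by (simp add: ip_eq_0_iff D_def fun_eq_iff)
  qed
  \<comment> \<open>A nonconstant \<open>W\<close> has a nonzero 2 by 2 minor with the constant
    vector, as the factorization of \<open>charpoly\<close> requires.\<close>
  have "\<exists>i j. W i \<noteq> W j"
  proof (rule ccontr)
    assume "\<not> ?thesis"
    hence "W = (\<lambda>_. W s0 * 1)" by (auto simp: fun_eq_iff)
    then obtain c where Wc: "W = (\<lambda>_. c * 1)" by blast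
    have "c = 0" using W1 unfolding Wc ip_scale_right ip_1_1 by simp
    hence "W = (\<lambda>_. 0)" using Wc by simp
    thus False using WW by (simp add: ip_def)
  qed
  then obtain i j where ij: "W i \<noteq> W j" by blast
  have beta: "\<bar>\<beta>\<bar> \<le> 1" using Pop_abs_le[of W] by (simp add: \<beta>_def WW)
  have "\<beta> \<le> eigenvalue_list P ! 1"
  proof (rule eigenvalue_list_second_ge)
    show "P *v 1 = 1 *s 1" by (simp add: vec_eq_iff Pop_eq_matrix) (simp add: Pop_def P_sum)
    show "P *v w = \<beta> *s w" using eigen by (simp add: vec_eq_iff Pop_eq_matrix fun_eq_iff W_def)
    show "(1 :: real ^ 's) $ j * w $ i \<noteq> 1 $ i * w $ j" using ij by (simp add: W_def)
  qed (use beta charpoly_nonzero in auto)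
  hence bg: "\<beta> \<le> 1 - spectral_gap P" by (simp add: spectral_gap_def)
  thus "spectral_gap P \<le> 2" using beta by simp
  define a where "a = ip ?one \<phi>"
  define \<psi> where "\<psi> = (\<lambda>s. \<phi> s - a * 1)"
  have \<psi>1: "ip ?one \<psi> = 0" unfolding \<psi>_def ip_simps ip_1_1 by (simp add: a_def)
  have \<phi>: "\<phi> = (\<lambda>s. a * 1 + \<psi> s)" by (simp add: \<psi>_def)
  have n: "ip \<phi> \<phi> = a\<^sup>2 + ip \<psi> \<psi>"
    unfolding \<phi> ip_simps ip_1_1 ip_commute[of \<psi> ?one] \<psi>1 by (simp add: power2_eq_square)
  have "ip \<phi> (Pop \<phi>) = a\<^sup>2 + ip \<psi> (Pop \<psi>)"
    unfolding \<phi> Pop_add Pop_scale Pop_1 ip_simps ip_1_1 ip_commute[of \<psi> ?one] Pop_selfadjoint[of ?one] \<psi>1 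
    by (simp add: power2_eq_square)
  also have "\<dots> \<le> a\<^sup>2 + (1 - spectral_gap P) * ip \<psi> \<psi>"
    using quad[OF \<psi>1] mult_right_mono[OF bg ip_nonneg[of \<psi>]] by simp
  also have "\<dots> = (1 - spectral_gap P) * ip \<phi> \<phi> + spectral_gap P * a\<^sup>2"
    by (simp add: n algebra_simps)
  finally show "ip \<phi> (Pop \<phi>) \<le> (1 - spectral_gap P) * ip \<phi> \<phi> + spectral_gap P * (ip (\<lambda>_. 1) \<phi>)\<^sup>2"
    by (simp add: a_def)
qed

end

section \<open>The tilted operator\<close>

text \<open>For negative \<open>x = - y\<close> the quadratic is compared with 1 / exp y: its
  product with the lower Taylor bound 1 + y + y^2 / 2 of exp y is at least 1.\<close>

lemma exp_le_quadratic:
  fixes x :: real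
  assumes "x \<le> 1"
  shows "exp x \<le> 1 + x + x\<^sup>2"
proof (cases "0 \<le> x")
  case True
  thus ?thesis using exp_bound assms by blast
next
  case False
  define y where "y = - x"
  have y: "y > 0" using False by (simp add: y_def)
  have e: "1 + y + y\<^sup>2 / 2 \<le> exp y" using exp_lower_Taylor_quadratic y by simp
  have "1 \<le> 1 + y\<^sup>2 / 2 + y ^ 3 / 2 + y ^ 4 / 2" using y by simp
  also have "\<dots> = (1 - y + y\<^sup>2) * (1 + y + y\<^sup>2 / 2)"
    by (simp add: field_simps power2_eq_square power3_eq_cube power4_eq_xxxx)
  also have "\<dots> \<le> (1 - y + y\<^sup>2) * exp y"
  proof (rule mult_left_mono[OF e])
    have "0 \<le> (1 - y / 2)\<^sup>2 + 3 / 4 * y\<^sup>2" by simp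
    thus "0 \<le> 1 - y + y\<^sup>2" by (simp add: power2_eq_square algebra_simps)
  qed
  finally have "exp (- y) \<le> 1 - y + y\<^sup>2"
    by (simp add: exp_minus field_simps)
  thus ?thesis by (simp add: y_def)
qed

text \<open>Here \<open>n\<^sup>2 = a\<^sup>2 + r\<^sup>2\<close> splits a function into its mean \<open>a\<close> and a mean-zero part of norm \<open>r\<close>. The
  gap contributes \<open>- g r\<^sup>2\<close>: half of it absorbs \<open>b r\<^sup>2\<close>, the other half the cross term \<open>2 b n r\<close>.\<close>

lemma quadratic_form_perturbation:
  fixes g b n r a :: real
  assumes "0 < g" "g \<le> 1" "0 \<le> b" "b \<le> g / 2" "0 \<le> r" "0 \<le> n" "0 \<le> a"
    and nar: "n\<^sup>2 = a\<^sup>2 + r\<^sup>2"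
    and E: "E \<le> (1 + b\<^sup>2) * n\<^sup>2 + 2 * a * b * r + b * r\<^sup>2"
    and k: "\<bar>k\<bar> \<le> a + b * r / 2 + b\<^sup>2 / 4 * n"
  shows "(1 - g) * E + g * k\<^sup>2 \<le> (1 + 3 * b\<^sup>2 / g) * n\<^sup>2"
proof -
  have an: "a \<le> n" and rn: "r \<le> n"
    using nar assms by (auto intro: power2_le_imp_le)
  have b1: "b \<le> 1 / 2" using assms by linarith
  have arn: "a * (b * r) \<le> n * (b * r)" using an assms by (intro mult_right_mono) auto
  have E': "E \<le> (1 + b\<^sup>2) * n\<^sup>2 + 2 * b * n * r + b * r\<^sup>2" using E arn by (simp add: mult_ac)
  have "k\<^sup>2 \<le> (a + (b * r / 2 + b\<^sup>2 / 4 * n))\<^sup>2"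
    using power_mono[OF k, of 2] by (simp add: add_ac)
  also have "\<dots> = a\<^sup>2 + a * (b * r) + b\<^sup>2 / 2 * (a * n) + (b * r / 2 + b\<^sup>2 / 4 * n)\<^sup>2"
    by (simp add: power2_eq_square algebra_simps)
  \<comment> \<open>Here r <= n and b <= 1/2 give the factor 1/2 + 1/8. Its square 25/64, added to
    the 1/2 from the cross term b^2 a n / 2, stays below 1.\<close>
  also have "(b * r / 2 + b\<^sup>2 / 4 * n)\<^sup>2 \<le> (b * n * (1 / 2 + 1 / 8))\<^sup>2"
  proof (rule power_mono)
    have "b * (b * n) \<le> 1 / 2 * (b * n)" using b1 assms by (intro mult_right_mono) auto
    moreover have "b * r \<le> b * n" using rn assms by (intro mult_left_mono) auto
    ultimately show "b * r / 2 + b\<^sup>2 / 4 * n \<le> b * n * (1 / 2 + 1 / 8)"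
      by (simp add: power2_eq_square)
  qed (use assms in auto)
  also have "b\<^sup>2 / 2 * (a * n) \<le> b\<^sup>2 / 2 * (n * n)"
    using an assms by (intro mult_left_mono mult_right_mono) auto
  finally have "k\<^sup>2 \<le> a\<^sup>2 + n * (b * r) + b\<^sup>2 / 2 * (n * n) + (b * n * (1 / 2 + 1 / 8))\<^sup>2"
    using arn by linarith
  also have "\<dots> \<le> a\<^sup>2 + b * n * r + b\<^sup>2 * n\<^sup>2"
  proof -
    have "(b * n * (1 / 2 + 1 / 8))\<^sup>2 = 25 / 64 * (b\<^sup>2 * n\<^sup>2)" by (simp add: power2_eq_square)
    moreover have "0 \<le> b\<^sup>2 * n\<^sup>2" by simp
    ultimately show ?thesis by (simp add: power2_eq_square mult_ac)
  qed
  finally have k': "k\<^sup>2 \<le> n\<^sup>2 - r\<^sup>2 + b * n * r + b\<^sup>2 * n\<^sup>2" using nar by simp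
  have pos: "0 \<le> g * (b * n * r)" "0 \<le> g * (b * r\<^sup>2)" using assms by simp_all
  have "(1 - g) * E + g * k\<^sup>2 \<le> (1 - g) * ((1 + b\<^sup>2) * n\<^sup>2 + 2 * b * n * r + b * r\<^sup>2)
      + g * (n\<^sup>2 - r\<^sup>2 + b * n * r + b\<^sup>2 * n\<^sup>2)"
    using E' k' assms by (intro add_mono mult_left_mono) auto
  also have "\<dots> = n\<^sup>2 + b\<^sup>2 * n\<^sup>2 + 2 * b * n * r - g * (b * n * r) + b * r\<^sup>2 - g * (b * r\<^sup>2) - g * r\<^sup>2"
    by (simp add: algebra_simps)
  also have "\<dots> \<le> n\<^sup>2 + b\<^sup>2 * n\<^sup>2 + 2 * b * n * r + b * r\<^sup>2 - g * r\<^sup>2"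
    using pos by linarith
  also have "\<dots> \<le> n\<^sup>2 + b\<^sup>2 * n\<^sup>2 + 2 * b * n * r - g / 2 * r\<^sup>2"
    using mult_right_mono[OF assms(4), of "r\<^sup>2"] by simp
  also have "\<dots> \<le> n\<^sup>2 + b\<^sup>2 * n\<^sup>2 + 2 * b\<^sup>2 / g * n\<^sup>2"
  \<comment> \<open>Completing the square in \<open>r\<close> costs 2 b^2 n^2 / g; with b^2 <= b^2 /
    g, from g <= 1, this makes the 3 of the conclusion.\<close>
  proof -
    have "0 \<le> (2 * b * n - g * r)\<^sup>2 / (2 * g)" using assms by simp
    also have "\<dots> = 2 * b\<^sup>2 / g * n\<^sup>2 - 2 * b * n * r + g / 2 * r\<^sup>2"
      using assms(1) by (simp add: field_simps power2_eq_square)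
    finally show ?thesis by simp
  qed
  also have "b\<^sup>2 * n\<^sup>2 \<le> b\<^sup>2 / g * n\<^sup>2"
    using assms(1,2) by (intro mult_right_mono) (auto simp: field_simps mult_left_le_one_le)
  finally show ?thesis using assms(1) by (simp add: field_simps)
qed

context reversible_chain
begin

text \<open>The gap inequality is applied to \<open>\<psi> = exp (h / 2) \<phi>\<close>, whose
  squared norm and mean are the \<open>E\<close> and \<open>k\<close> of
  \<open>quadratic_form_perturbation\<close>. The effect is of second order in \<open>b\<close>
  because the first-order term on constants is the mean of \<open>h\<close>, which is 0.\<close>

lemma tilted_form_le:
  assumes g: "0 < g" "g \<le> 1"
    and gap: "\<And>\<phi>. ip \<phi> (Pop \<phi>) \<le> (1 - g) * ip \<phi> \<phi> + g * (ip (\<lambda>_. 1) \<phi>)\<^sup>2"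
    and h: "\<And>s. \<bar>h s\<bar> \<le> b" and mean: "ip (\<lambda>_. 1) h = 0"
  shows "ip (\<lambda>s. exp (h s / 2) * \<phi> s) (Pop (\<lambda>s. exp (h s / 2) * \<phi> s)) \<le> exp (3 * b\<^sup>2 / g) * ip \<phi> \<phi>"
proof -
  define \<psi> where "\<psi> = (\<lambda>s. exp (h s / 2) * \<phi> s)"
  have b: "b \<ge> 0" using h[of undefined] by linarith
  have \<psi>\<psi>: "\<psi> s * \<psi> s = exp (h s) * \<phi> s * \<phi> s" for s
    unfolding \<psi>_def by (simp add: mult_ac mult_exp_exp)
  show ?thesis
  proof (cases "b \<le> g / 2")
    case False
    \<comment> \<open>Then \<open>b \<le> 2 b\<^sup>2 / g\<close>, and the trivial bound \<open>exp b\<close> suffices.\<close>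
    have "ip \<psi> (Pop \<psi>) \<le> ip \<psi> \<psi>" using Pop_abs_le[of \<psi>] by simp
    also have "\<dots> \<le> ip (\<lambda>s. exp b * \<phi> s) \<phi>"
    proof (rule ip_mono)
      fix s
      have "exp (h s) * (\<phi> s * \<phi> s) \<le> exp b * (\<phi> s * \<phi> s)"
        using h[of s] by (intro mult_right_mono) auto
      thus "\<psi> s * \<psi> s \<le> exp b * \<phi> s * \<phi> s" by (simp add: \<psi>\<psi> mult_ac)
    qed
    also have "\<dots> \<le> exp (3 * b\<^sup>2 / g) * ip \<phi> \<phi>"
      unfolding ip_scale_left
    proof (rule mult_right_mono[OF _ ip_nonneg])
      have "b * g \<le> b * (2 * b)" using False b by (intro mult_left_mono) auto
      moreover have "0 \<le> b * b" by simp
      ultimately have "b * g \<le> 3 * b\<^sup>2" unfolding power2_eq_square by linarith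
      thus "exp b \<le> exp (3 * b\<^sup>2 / g)" using g by (simp add: field_simps)
    qed
    finally show ?thesis by (simp add: \<psi>_def)
  next
    case True
    define a where "a = ip (\<lambda>_. 1) \<phi>"
    define \<theta> where "\<theta> = (\<lambda>s. \<phi> s - a * 1)"
    define n r where "n = sqrt (ip \<phi> \<phi>)" and "r = sqrt (ip \<theta> \<theta>)"
    have \<theta>1: "ip (\<lambda>_. 1) \<theta> = 0" unfolding \<theta>_def ip_simps ip_1_1 by (simp add: a_def)
    have \<phi>: "\<phi> = (\<lambda>s. a * 1 + \<theta> s)" by (simp add: \<theta>_def)
    have n2: "n\<^sup>2 = ip \<phi> \<phi>" and r2: "r\<^sup>2 = ip \<theta> \<theta>" by (simp_all add: n_def r_def ip_nonneg)
    have "ip \<phi> \<phi> = a\<^sup>2 + ip \<theta> \<theta>"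
      unfolding \<phi> ip_simps ip_1_1 ip_commute[of \<theta> "\<lambda>_. 1"] \<theta>1 by (simp add: power2_eq_square)
    hence nar: "n\<^sup>2 = \<bar>a\<bar>\<^sup>2 + r\<^sup>2" by (simp add: n2 r2)
    have h\<theta>: "\<bar>ip h \<theta>\<bar> \<le> b * r" unfolding r_def by (rule ip_bounded_le[OF h b])
    have "ip \<psi> \<psi> \<le> ip (\<lambda>s. (1 + b\<^sup>2) * \<phi> s) \<phi> + (a * a * ip (\<lambda>_. 1) h + 2 * a * ip h \<theta> + ip (\<lambda>s. b * \<theta> s) \<theta>)"
    proof -
      have "ip \<psi> \<psi> \<le> ip (\<lambda>_. 1) (\<lambda>s. (1 + b\<^sup>2) * (\<phi> s * \<phi> s) + (a * a * h s + 2 * a * (h s * \<theta> s) + b * (\<theta> s * \<theta> s)))"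
      proof (rule ip_mono)
        fix s
        have "h s \<le> 1" using h[of s] True g by linarith
        hence "exp (h s) \<le> 1 + h s + (h s)\<^sup>2" by (rule exp_le_quadratic)
        also have "(h s)\<^sup>2 \<le> b\<^sup>2" using h[of s] b abs_le_square_iff[of "h s" b] by simp
        finally have "exp (h s) * (\<phi> s * \<phi> s) \<le> (1 + h s + b\<^sup>2) * (\<phi> s * \<phi> s)"
          by (intro mult_right_mono) auto
        \<comment> \<open>Only the term linear in \<open>h\<close> is split along
          \<open>\<phi> = a + \<theta>\<close>: its \<open>a * a\<close> part integrates to 0, and
          each remaining part carries a factor \<open>\<theta>\<close>.\<close>
        also have "\<dots> = (1 + b\<^sup>2) * (\<phi> s * \<phi> s) + (a * a * h s + 2 * a * (h s * \<theta> s) + h s * (\<theta> s * \<theta> s))"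
          by (simp add: \<theta>_def algebra_simps)
        also have "h s * (\<theta> s * \<theta> s) \<le> b * (\<theta> s * \<theta> s)"
          using h[of s] by (intro mult_right_mono) auto
        finally show "\<psi> s * \<psi> s \<le> 1 * ((1 + b\<^sup>2) * (\<phi> s * \<phi> s) + (a * a * h s + 2 * a * (h s * \<theta> s) + b * (\<theta> s * \<theta> s)))"
          by (simp add: \<psi>\<psi> mult_ac)
      qed
      also have "\<dots> = (1 + b\<^sup>2) * ip (\<lambda>_. 1) (\<lambda>s. \<phi> s * \<phi> s) + (a * a * ip (\<lambda>_. 1) h
          + 2 * a * ip (\<lambda>_. 1) (\<lambda>s. h s * \<theta> s) + b * ip (\<lambda>_. 1) (\<lambda>s. \<theta> s * \<theta> s))"
        unfolding ip_simps ..
      finally show ?thesis unfolding ip_simps by (simp add: ip_def)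
    qed
    hence "ip \<psi> \<psi> \<le> (1 + b\<^sup>2) * n\<^sup>2 + 2 * (a * ip h \<theta>) + b * r\<^sup>2"
      by (simp add: mean ip_simps n2 r2)
    moreover have "a * ip h \<theta> \<le> \<bar>a\<bar> * (b * r)"
      using mult_left_mono[OF h\<theta>, of "\<bar>a\<bar>"] by (simp add: abs_mult[symmetric])
    ultimately have E: "ip \<psi> \<psi> \<le> (1 + b\<^sup>2) * n\<^sup>2 + 2 * \<bar>a\<bar> * b * r + b * r\<^sup>2" by (simp add: mult_ac)
    have k: "\<bar>ip (\<lambda>_. 1) \<psi>\<bar> \<le> \<bar>a\<bar> + b * r / 2 + b\<^sup>2 / 4 * n"
    proof -
      define \<rho> where "\<rho> = (\<lambda>s. exp (h s / 2) - 1 - h s / 2)"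
      have "\<bar>\<rho> s\<bar> \<le> b\<^sup>2 / 4" for s
      proof -
        have "exp (h s / 2) \<le> 1 + h s / 2 + (h s)\<^sup>2 / 4"
          using exp_le_quadratic[of "h s / 2"] h[of s] True g by (simp add: power_divide)
        moreover have "1 + h s / 2 \<le> exp (h s / 2)" by (rule exp_ge_add_one_self)
        moreover have "(h s)\<^sup>2 \<le> b\<^sup>2" using h[of s] b abs_le_square_iff[of "h s" b] by simp
        ultimately show ?thesis unfolding \<rho>_def by linarith
      qed
      hence \<rho>: "\<bar>ip \<rho> \<phi>\<bar> \<le> b\<^sup>2 / 4 * n" unfolding n_def by (rule ip_bounded_le) simp
      have "ip h \<phi> = ip h \<theta>" unfolding \<phi> ip_simps ip_commute[of h "\<lambda>_. 1"] mean by simp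
      moreover have "ip (\<lambda>_. 1) \<psi> = ip (\<lambda>_. 1) \<phi> + 1 / 2 * ip h \<phi> + ip \<rho> \<phi>"
        unfolding ip_simps(1-3)[symmetric] by (simp add: ip_def \<psi>_def \<rho>_def algebra_simps)
      ultimately have "ip (\<lambda>_. 1) \<psi> = a + 1 / 2 * ip h \<theta> + ip \<rho> \<phi>" by (simp add: a_def)
      thus ?thesis using h\<theta> \<rho> by linarith
    qed
    have "ip \<psi> (Pop \<psi>) \<le> (1 - g) * ip \<psi> \<psi> + g * (ip (\<lambda>_. 1) \<psi>)\<^sup>2" by (rule gap)
    also have "\<dots> \<le> (1 + 3 * b\<^sup>2 / g) * n\<^sup>2"
      by (rule quadratic_form_perturbation[OF g b True _ _ _ nar E k])
         (simp_all add: r_def n_def ip_nonneg)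
    also have "\<dots> \<le> exp (3 * b\<^sup>2 / g) * n\<^sup>2"
      by (intro mult_right_mono exp_ge_add_one_self) simp
    finally show ?thesis by (simp add: \<psi>_def n2)
  qed
qed

text \<open>The symmetrization \<open>D\<^bsup>1/2\<^esup> P D\<^bsup>1/2\<^esup>\<close> of \<open>P D\<close>, where \<open>D\<close> is multiplication by \<open>exp h\<close>.\<close>

definition tilt :: "('s \<Rightarrow> real) \<Rightarrow> ('s \<Rightarrow> real) \<Rightarrow> 's \<Rightarrow> real" where
  "tilt h \<phi> s = exp (h s / 2) * Pop (\<lambda>s. exp (h s / 2) * \<phi> s) s"

text \<open>The entries of the symmetrized operator are nonnegative, so an upper bound for the form also bounds
  it from below; polarization then bounds the operator norm.\<close>

lemma tilt_bound:
  assumes c: "c > 0"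
    and form: "\<And>\<phi>. ip (\<lambda>s. exp (h s / 2) * \<phi> s) (Pop (\<lambda>s. exp (h s / 2) * \<phi> s)) \<le> c * ip \<phi> \<phi>"
  shows "ip (tilt h \<phi>) (tilt h \<phi>) \<le> c\<^sup>2 * ip \<phi> \<phi>"
proof -
  have tilt_ip: "ip \<phi> (tilt h \<psi>) = ip (\<lambda>s. exp (h s / 2) * \<phi> s) (Pop (\<lambda>s. exp (h s / 2) * \<psi> s))" for \<phi> \<psi>
    by (simp add: ip_def tilt_def mult_ac)
  have sym: "ip \<phi> (tilt h \<psi>) = ip \<psi> (tilt h \<phi>)" for \<phi> \<psi>
    unfolding tilt_ip by (subst Pop_selfadjoint, subst ip_commute) simp
  have quad: "\<bar>ip \<phi> (tilt h \<phi>)\<bar> \<le> c * ip \<phi> \<phi>" for \<phi>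
  proof -
    have "\<bar>ip \<phi> (tilt h \<phi>)\<bar> \<le> ip (\<lambda>s. \<bar>\<phi> s\<bar>) (tilt h (\<lambda>s. \<bar>\<phi> s\<bar>))"
      unfolding tilt_ip ip_Pop using P_nonneg
      by (intro order_trans[OF sum_abs] sum_mono) (simp add: abs_mult)
    also have "\<dots> \<le> c * ip (\<lambda>s. \<bar>\<phi> s\<bar>) (\<lambda>s. \<bar>\<phi> s\<bar>)" unfolding tilt_ip by (rule form)
    also have "ip (\<lambda>s. \<bar>\<phi> s\<bar>) (\<lambda>s. \<bar>\<phi> s\<bar>) = ip \<phi> \<phi>" by (simp add: ip_def)
    finally show ?thesis .
  qed
  have tadd: "tilt h (\<lambda>s. \<phi> s + \<psi> s) = (\<lambda>s. tilt h \<phi> s + tilt h \<psi> s)" for \<phi> \<psi>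
    by (simp add: tilt_def fun_eq_iff distrib_left Pop_add)
  have tdiff: "tilt h (\<lambda>s. \<phi> s - \<psi> s) = (\<lambda>s. tilt h \<phi> s - tilt h \<psi> s)" for \<phi> \<psi>
    by (simp add: tilt_def fun_eq_iff right_diff_distrib Pop_diff)
  have tscale: "tilt h (\<lambda>s. k * \<phi> s) = (\<lambda>s. k * tilt h \<phi> s)" for k \<phi>
    using Pop_scale[of k "\<lambda>s. exp (h s / 2) * \<phi> s"] by (simp add: tilt_def fun_eq_iff mult_ac)
  \<comment> \<open>Scaling \<phi> by \<open>c\<close> balances the polarization: 4 c |x|^2 <= 2 c
    (|x|^2 + |y|^2) collapses to |x| <= |y|.\<close>
  define x y where "x = tilt h \<phi>" and "y = (\<lambda>s. c * \<phi> s)"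
  have ty: "tilt h y = (\<lambda>s. c * x s)" by (simp add: x_def y_def tscale)
  have "4 * ip x (tilt h y) = ip (\<lambda>s. x s + y s) (tilt h (\<lambda>s. x s + y s)) - ip (\<lambda>s. x s - y s) (tilt h (\<lambda>s. x s - y s))"
    unfolding tadd tdiff ip_simps using sym[of x y] by simp
  also have "\<dots> \<le> c * ip (\<lambda>s. x s + y s) (\<lambda>s. x s + y s) + c * ip (\<lambda>s. x s - y s) (\<lambda>s. x s - y s)"
    using quad[of "\<lambda>s. x s + y s"] quad[of "\<lambda>s. x s - y s"] by (simp add: abs_le_iff)
  also have "\<dots> = 2 * c * (ip x x + ip y y)"
    unfolding ip_simps by (simp add: algebra_simps)
  finally have "4 * (c * ip x x) \<le> 2 * c * (ip x x + ip y y)" unfolding ty ip_simps .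
  hence "c * ip x x \<le> c * ip y y" by (simp add: algebra_simps)
  hence "ip x x \<le> ip y y" using c by simp
  thus ?thesis unfolding x_def y_def ip_simps by (simp add: power2_eq_square mult_ac)
qed

text \<open>Multiplication precedes \<open>Pop\<close> because the sums start at time 1: the
  \<open>n\<close>-th iterate on the constant 1, at \<open>s\<close>, is the expectation of exp
  (h(s_1) + ... + h(s_n)) for the chain started at \<open>s\<close>.\<close>

definition weighted_step :: "('s \<Rightarrow> real) \<Rightarrow> ('s \<Rightarrow> real) \<Rightarrow> 's \<Rightarrow> real" where
  "weighted_step h \<phi> = Pop (\<lambda>s. exp (h s) * \<phi> s)"

text \<open>The functions \<open>G n = exp (h / 2) F n\<close> evolve by the symmetric
  \<open>tilt h\<close>, whose norm is at most \<open>c\<close>. Entering and leaving this picture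
  costs exp b each in the squared norm, hence a single exp b after the root.\<close>

lemma weighted_step_funpow_bound:
  assumes g: "0 < g" "g \<le> 1"
    and gap: "\<And>\<phi>. ip \<phi> (Pop \<phi>) \<le> (1 - g) * ip \<phi> \<phi> + g * (ip (\<lambda>_. 1) \<phi>)\<^sup>2"
    and h: "\<And>s. \<bar>h s\<bar> \<le> b" and mean: "ip (\<lambda>_. 1) h = 0"
  shows "sqrt (ip ((weighted_step h ^^ N) (\<lambda>_. 1)) ((weighted_step h ^^ N) (\<lambda>_. 1)))
    \<le> exp (b + 3 * b\<^sup>2 / g * real N)"
proof -
  define F where "F n = (weighted_step h ^^ n) (\<lambda>_. 1)" for n
  define G where "G n = (\<lambda>s. exp (h s / 2) * F n s)" for n
  define c where "c = exp (3 * b\<^sup>2 / g)"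
  have bnd: "exp (- b) \<le> exp (h s)" "exp (h s) \<le> exp b" for s using h[of s] by auto
  have "exp (h s / 2) * exp (h s / 2) = exp (h s)" for s by (simp add: mult_exp_exp)
  hence GF: "G n s * G n s = exp (h s) * (F n s * F n s)" for n s
    by (metis (no_types, lifting) G_def mult.assoc mult.commute)
  have GSuc: "G (Suc n) = tilt h (G n)" for n
    by (simp add: G_def F_def tilt_def weighted_step_def fun_eq_iff mult_exp_exp flip: mult.assoc)
  have "ip (G n) (G n) \<le> (c\<^sup>2) ^ n * exp b" for n
  proof (induction n)
    case 0
    have "ip (G 0) (G 0) \<le> ip (\<lambda>s. exp b * 1) (\<lambda>_. 1)"
      by (rule ip_mono) (use bnd(2) GF[of 0] in \<open>simp add: F_def\<close>)
    thus ?case unfolding ip_scale_left ip_1_1 by simp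
  next
    case (Suc n)
    have "ip (G (Suc n)) (G (Suc n)) \<le> c\<^sup>2 * ip (G n) (G n)"
      unfolding GSuc c_def by (rule tilt_bound) (simp, rule tilted_form_le[OF g gap h mean])
    also have "\<dots> \<le> c\<^sup>2 * ((c\<^sup>2) ^ n * exp b)" by (intro mult_left_mono Suc.IH) simp
    finally show ?case by (simp add: mult_ac)
  qed
  note GN = this[of N]
  have "ip (F N) (F N) \<le> ip (\<lambda>s. exp b * G N s) (G N)"
  proof (rule ip_mono)
    fix s
    have "1 * (F N s * F N s) \<le> (exp b * exp (h s)) * (F N s * F N s)"
      using h[of s] by (intro mult_right_mono) (auto simp: mult_exp_exp)
    also have "\<dots> = exp b * (G N s * G N s)" unfolding GF by (simp only: mult_ac)
    finally show "F N s * F N s \<le> exp b * G N s * G N s" by (simp add: mult_ac)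
  qed
  also have "\<dots> \<le> exp b * ((c\<^sup>2) ^ N * exp b)"
    unfolding ip_scale_left by (intro mult_left_mono GN) simp
  also have "\<dots> = (exp (b + 3 * b\<^sup>2 / g * real N))\<^sup>2"
    unfolding c_def by (simp add: exp_of_nat_mult[symmetric] mult_exp_exp power2_eq_square algebra_simps)
  finally show ?thesis by (simp add: F_def real_le_lsqrt)
qed

end

section \<open>Gaussian averaging\<close>

lemma sum_exp_square_le:
  fixes w z :: "'a \<Rightarrow> real"
  assumes "finite J" "\<And>j. j \<in> J \<Longrightarrow> w j \<ge> 0" "K > 0"
    and le: "\<And>u. (\<Sum>j\<in>J. w j * exp (u * z j)) \<le> C * exp (K * u\<^sup>2)"
  shows "(\<Sum>j\<in>J. w j * exp ((z j)\<^sup>2 / (8 * K))) \<le> sqrt 2 * C"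
proof -
  \<comment> \<open>Integrate the hypothesis over a centred normal \<open>u\<close> of variance \<open>1 / (4 K)\<close>; the right-hand side then
    turns into \<open>sqrt 2\<close> times the normal density of variance \<open>1 / (2 K)\<close>.\<close>
  define \<sigma> \<tau> where "\<sigma> = 1 / sqrt (4 * K)" and "\<tau> = 1 / sqrt (2 * K)"
  have \<sigma>: "\<sigma> > 0" "\<sigma>\<^sup>2 = 1 / (4 * K)" and \<tau>: "\<tau> > 0" "\<tau>\<^sup>2 = 1 / (2 * K)"
    using assms(3) by (simp_all add: \<sigma>_def \<tau>_def power_divide)
  \<comment> \<open>Completing the square: the factor exp (u c) shifts the mean by
    \<open>c * \<sigma>\<^sup>2\<close> and leaves exp (c^2 \<sigma>^2 / 2), the source of the
    8.\<close>
  have 1: "exp (c\<^sup>2 / (8 * K)) * normal_density (c * \<sigma>\<^sup>2) \<sigma> u = normal_density 0 \<sigma> u * exp (u * c)" for c u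
  proof -
    have "c\<^sup>2 / (8 * K) + - (u - c * \<sigma>\<^sup>2)\<^sup>2 / (2 * \<sigma>\<^sup>2) = - (u - 0)\<^sup>2 / (2 * \<sigma>\<^sup>2) + u * c"
      unfolding \<sigma> using assms(3) by (simp add: field_simps power2_eq_square)
    hence "exp (c\<^sup>2 / (8 * K)) * exp (- (u - c * \<sigma>\<^sup>2)\<^sup>2 / (2 * \<sigma>\<^sup>2)) = exp (- (u - 0)\<^sup>2 / (2 * \<sigma>\<^sup>2)) * exp (u * c)"
      unfolding mult_exp_exp by simp
    thus ?thesis unfolding normal_density_def by simp
  qed
  \<comment> \<open>The exponent coefficient 1 / (2 \<sigma>^2) = 2 K drops to K, so the variance
    doubles and the normalizing constants leave \<open>sqrt 2\<close>.\<close>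
  have 2: "normal_density 0 \<sigma> u * exp (K * u\<^sup>2) = sqrt 2 * normal_density 0 \<tau> u" for u
  proof -
    have "- (u - 0)\<^sup>2 / (2 * \<sigma>\<^sup>2) + K * u\<^sup>2 = - (u - 0)\<^sup>2 / (2 * \<tau>\<^sup>2)"
      unfolding \<sigma> \<tau> using assms(3) by (simp add: field_simps)
    hence e: "exp (- (u - 0)\<^sup>2 / (2 * \<sigma>\<^sup>2)) * exp (K * u\<^sup>2) = exp (- (u - 0)\<^sup>2 / (2 * \<tau>\<^sup>2))"
      unfolding mult_exp_exp by simp
    have "2 * pi * \<tau>\<^sup>2 = 2 * (2 * pi * \<sigma>\<^sup>2)" unfolding \<sigma> \<tau> using assms(3) by (simp add: field_simps)
    hence "sqrt (2 * pi * \<tau>\<^sup>2) = sqrt 2 * sqrt (2 * pi * \<sigma>\<^sup>2)" by (simp only: real_sqrt_mult)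
    hence "1 / sqrt (2 * pi * \<sigma>\<^sup>2) = sqrt 2 * (1 / sqrt (2 * pi * \<tau>\<^sup>2))"
      using \<tau> \<sigma>(1) by simp
    thus ?thesis unfolding normal_density_def by (simp only: e mult.assoc)
  qed
  have "(\<Sum>j\<in>J. w j * exp ((z j)\<^sup>2 / (8 * K)))
      = (\<integral>u. (\<Sum>j\<in>J. (w j * exp ((z j)\<^sup>2 / (8 * K))) * normal_density (z j * \<sigma>\<^sup>2) \<sigma> u) \<partial>lborel)"
    using \<sigma>(1) by (subst Bochner_Integration.integral_sum) auto
  also have "\<dots> \<le> (\<integral>u. C * sqrt 2 * normal_density 0 \<tau> u \<partial>lborel)"
  proof (rule integral_mono)
    fix u
    have "(\<Sum>j\<in>J. (w j * exp ((z j)\<^sup>2 / (8 * K))) * normal_density (z j * \<sigma>\<^sup>2) \<sigma> u)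
        = normal_density 0 \<sigma> u * (\<Sum>j\<in>J. w j * exp (u * z j))"
      unfolding sum_distrib_left mult.assoc 1 by (simp only: mult_ac)
    also have "\<dots> \<le> normal_density 0 \<sigma> u * (C * exp (K * u\<^sup>2))"
      by (intro mult_left_mono le normal_density_nonneg)
    also have "\<dots> = C * (normal_density 0 \<sigma> u * exp (K * u\<^sup>2))" by (simp only: mult_ac)
    finally show "(\<Sum>j\<in>J. (w j * exp ((z j)\<^sup>2 / (8 * K))) * normal_density (z j * \<sigma>\<^sup>2) \<sigma> u)
        \<le> C * sqrt 2 * normal_density 0 \<tau> u" unfolding 2 by (simp add: mult_ac)
  qed (use \<sigma>(1) \<tau>(1) in auto)
  also have "\<dots> = sqrt 2 * C" using \<tau>(1) by simp
  finally show ?thesis .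
qed

text \<open>Both exponentials factor over the coordinates, so the Gaussian vector is integrated out
  one coordinate at a time at the price of \<open>sqrt 2\<close> each; the other factors go into the
  weights and the constant.\<close>

lemma sum_exp_norm_square_le:
  fixes w :: "'a \<Rightarrow> real" and Z :: "'a \<Rightarrow> real ^ 'm::finite"
  assumes J: "finite J" "\<And>j. j \<in> J \<Longrightarrow> w j \<ge> 0" "K > 0"
    and le: "\<And>u. (\<Sum>j\<in>J. w j * exp (u \<bullet> Z j)) \<le> C * exp (K * (norm u)\<^sup>2)"
  shows "(\<Sum>j\<in>J. w j * exp ((norm (Z j))\<^sup>2 / (8 * K))) \<le> sqrt 2 ^ CARD('m) * C"
proof -
  \<comment> \<open>The coordinates in \<open>I\<close> are already integrated out.\<close>
  have "(\<Sum>j\<in>J. w j * exp (\<Sum>i\<in>I. (Z j $ i)\<^sup>2 / (8 * K)) * exp (\<Sum>i\<in>-I. u $ i * Z j $ i))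
      \<le> sqrt 2 ^ card I * C * exp (K * (\<Sum>i\<in>-I. (u $ i)\<^sup>2))" for I u
    using finite[of I]
  proof (induction I arbitrary: u rule: finite_induct)
    case empty
    show ?case using le[of u]
      by (simp add: inner_vec_def norm_vec_def L2_set_def sum_nonneg)
  next
    case (insert k I)
    define R where "R = - insert k I"
    have kR: "k \<notin> R" "- I = insert k R" using insert.hyps by (auto simp: R_def)
    have "(\<Sum>j\<in>J. (w j * exp (\<Sum>i\<in>I. (Z j $ i)\<^sup>2 / (8 * K)) * exp (\<Sum>i\<in>R. u $ i * Z j $ i)) * exp (t * Z j $ k))
        \<le> (sqrt 2 ^ card I * C * exp (K * (\<Sum>i\<in>R. (u $ i)\<^sup>2))) * exp (K * t\<^sup>2)" for t
    proof -
      define v where "v = (\<chi> i. if i = k then t else u $ i)"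
      have v: "v $ k = t" "(\<Sum>i\<in>R. v $ i * y i) = (\<Sum>i\<in>R. u $ i * y i)"
         "(\<Sum>i\<in>R. (v $ i)\<^sup>2) = (\<Sum>i\<in>R. (u $ i)\<^sup>2)" for y
        using kR(1) by (auto simp: v_def intro!: sum.cong)
      show ?thesis using insert.IH[of v] kR(1)
        by (simp add: kR(2) v exp_add distrib_left mult_ac)
    qed
    hence "(\<Sum>j\<in>J. (w j * exp (\<Sum>i\<in>I. (Z j $ i)\<^sup>2 / (8 * K)) * exp (\<Sum>i\<in>R. u $ i * Z j $ i)) * exp ((Z j $ k)\<^sup>2 / (8 * K)))
        \<le> sqrt 2 * (sqrt 2 ^ card I * C * exp (K * (\<Sum>i\<in>R. (u $ i)\<^sup>2)))"
      using J by (intro sum_exp_square_le) auto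
    thus ?case using insert.hyps by (simp add: exp_add mult_ac flip: R_def)
  qed
  from this[of UNIV 0] show ?thesis
    by (simp add: norm_vec_def L2_set_def sum_nonneg flip: sum_divide_distrib)
qed

section \<open>Sums over paths and the tail bound\<close>

lemma sum_PiE_insert:
  fixes F :: "('i \<Rightarrow> 's::finite) \<Rightarrow> 'b::comm_monoid_add"
  assumes "i \<notin> S"
  shows "(\<Sum>x\<in>PiE (insert i S) (\<lambda>_. UNIV). F x) = (\<Sum>g\<in>PiE S (\<lambda>_. UNIV). \<Sum>y\<in>UNIV. F (g(i := y)))"
proof -
  have "(\<Sum>x\<in>PiE (insert i S) (\<lambda>_. UNIV). F x)
      = (\<Sum>(y, g)\<in>UNIV \<times> PiE S (\<lambda>_. UNIV). F (g(i := y)))"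
    unfolding PiE_insert_eq
    by (subst sum.reindex[OF inj_combinator[OF assms]]) (simp add: case_prod_beta o_def)
  also have "\<dots> = (\<Sum>y\<in>UNIV. \<Sum>g\<in>PiE S (\<lambda>_. UNIV). F (g(i := y)))"
    by (simp add: sum.cartesian_product)
  also have "\<dots> = (\<Sum>g\<in>PiE S (\<lambda>_. UNIV). \<Sum>y\<in>UNIV. F (g(i := y)))"
    by (rule sum.swap)
  finally show ?thesis .
qed

definition path_prob :: "'w measure \<Rightarrow> (nat \<Rightarrow> 'w \<Rightarrow> 's) \<Rightarrow> nat \<Rightarrow> (nat \<Rightarrow> 's) \<Rightarrow> real" where
  "path_prob M X n x = measure M {\<omega>\<in>space M. \<forall>t\<le>n. X t \<omega> = x t}"

lemma path_prob_cong: "(\<And>t. t \<le> n \<Longrightarrow> x t = y t) \<Longrightarrow> path_prob M X n x = path_prob M X n y"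
  by (simp add: path_prob_def cong: conj_cong)

text \<open>The event is covered by the finitely many cylinder events of the paths in
  \<open>A\<close>; the rest of the argument is then about finite sums.\<close>

lemma measure_le_sum_path_prob:
  fixes X :: "nat \<Rightarrow> 'w \<Rightarrow> 's::finite"
  assumes "prob_space M" "\<And>t. X t \<in> measurable M (count_space UNIV)"
    and Q: "\<And>\<omega>. \<omega> \<in> space M \<Longrightarrow> Q \<omega> \<Longrightarrow> restrict (\<lambda>t. X t \<omega>) {..n} \<in> A"
    and A: "A \<subseteq> PiE {..n} (\<lambda>_. UNIV)"
  shows "measure M {\<omega>\<in>space M. Q \<omega>} \<le> (\<Sum>x\<in>A. path_prob M X n x)"
proof -
  interpret prob_space M by fact
  define B where "B x = {\<omega>\<in>space M. \<forall>t\<le>n. X t \<omega> = x t}" for x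
  have fin: "finite A" by (rule finite_subset[OF A]) (simp add: finite_PiE)
  have B: "B x \<in> sets M" for x
  proof -
    have "X t \<in> measurable M (count_space UNIV)" for t by fact
    note [measurable] = this
    show ?thesis unfolding B_def by measurable
  qed
  have "measure M {\<omega>\<in>space M. Q \<omega>} \<le> measure M (\<Union>x\<in>A. B x)"
  proof (rule finite_measure_mono)
    show "{\<omega>\<in>space M. Q \<omega>} \<subseteq> (\<Union>x\<in>A. B x)"
      using Q by (fastforce simp: B_def)
    show "(\<Union>x\<in>A. B x) \<in> sets M" using fin B by (intro sets.finite_UN) auto
  qed
  also have "\<dots> \<le> (\<Sum>x\<in>A. measure M (B x))"
    using fin B by (intro finite_measure_subadditive_finite) auto
  finally show ?thesis by (simp add: path_prob_def B_def)
qed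

context reversible_chain
begin

text \<open>Summing out the last state replaces \<phi> by \<open>weighted_step h \<phi>\<close>, so
  the induction must keep \<phi> arbitrary.\<close>

lemma sum_paths_weighted:
  assumes chain: "markov_chain M X P \<mu>0"
  shows "(\<Sum>x\<in>PiE {..n} (\<lambda>_. UNIV). path_prob M X n x * exp (\<Sum>t=1..n. h (x t)) * \<phi> (x n))
    = (\<Sum>s\<in>UNIV. pmf \<mu>0 s * (weighted_step h ^^ n) \<phi> s)"
proof (induction n arbitrary: \<phi>)
  case 0
  have "path_prob M X 0 x = pmf \<mu>0 (x 0)" for x
    using chain by (simp add: path_prob_def markov_chain_def)
  moreover have "{..0::nat} = insert 0 {}" by auto
  ultimately show ?case by (simp add: sum_PiE_insert del: PiE_empty_domain) (simp add: PiE_empty_domain)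
next
  case (Suc n)
  have pp: "path_prob M X (Suc n) (x(Suc n := y)) = path_prob M X n x * P $ x n $ y" for x y
  proof -
    have "path_prob M X (Suc n) (x(Suc n := y)) = path_prob M X n (x(Suc n := y)) * P $ x n $ y"
      using chain by (simp add: path_prob_def markov_chain_def)
    also have "path_prob M X n (x(Suc n := y)) = path_prob M X n x"
      by (rule path_prob_cong) simp
    finally show ?thesis .
  qed
  have ins: "{..Suc n} = insert (Suc n) {..n}" by auto
  have "(\<Sum>x\<in>PiE {..Suc n} (\<lambda>_. UNIV). path_prob M X (Suc n) x * exp (\<Sum>t=1..Suc n. h (x t)) * \<phi> (x (Suc n)))
      = (\<Sum>x\<in>PiE {..n} (\<lambda>_. UNIV). \<Sum>y\<in>UNIV. path_prob M X n x * exp (\<Sum>t=1..n. h (x t)) * (P $ x n $ y * (exp (h y) * \<phi> y)))"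
    unfolding ins
  proof (subst sum_PiE_insert, simp, intro sum.cong refl)
    fix x y
    have "(\<Sum>t=1..n. h ((x(Suc n := y)) t)) = (\<Sum>t=1..n. h (x t))" by (intro sum.cong) auto
    thus "path_prob M X (Suc n) (x(Suc n := y)) * exp (\<Sum>t=1..Suc n. h ((x(Suc n := y)) t)) * \<phi> ((x(Suc n := y)) (Suc n))
        = path_prob M X n x * exp (\<Sum>t=1..n. h (x t)) * (P $ x n $ y * (exp (h y) * \<phi> y))"
      unfolding pp by (simp add: exp_add)
  qed
  also have "\<dots> = (\<Sum>x\<in>PiE {..n} (\<lambda>_. UNIV). path_prob M X n x * exp (\<Sum>t=1..n. h (x t)) * weighted_step h \<phi> (x n))"
    by (simp add: weighted_step_def Pop_def sum_distrib_left)
  also have "\<dots> = (\<Sum>s\<in>UNIV. pmf \<mu>0 s * (weighted_step h ^^ n) (weighted_step h \<phi>) s)" by (rule Suc.IH)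
  finally show ?case by (simp only: funpow_Suc_right o_apply)
qed

lemma sum_initial_le: "(\<Sum>s\<in>UNIV. pmf \<mu>0 s * \<phi> s) \<le> density_norm \<mu>0 \<mu> * sqrt (ip \<phi> \<phi>)"
proof -
  define \<rho> where "\<rho> = (\<lambda>s. pmf \<mu>0 s / pmf \<mu> s)"
  have "ip \<rho> \<rho> = measure_pmf.expectation \<mu> (\<lambda>s. (pmf \<mu>0 s / pmf \<mu> s)\<^sup>2)"
    by (subst integral_measure_pmf[of UNIV]) (auto simp: ip_def \<rho>_def power2_eq_square)
  hence "sqrt (ip \<rho> \<rho>) = density_norm \<mu>0 \<mu>" by (simp add: density_norm_def)
  moreover have "(\<Sum>s\<in>UNIV. pmf \<mu>0 s * \<phi> s) = ip \<rho> \<phi>"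
    unfolding ip_def \<rho>_def using pos by (intro sum.cong) (auto simp: less_imp_neq[symmetric])
  ultimately show ?thesis using ip_Cauchy_Schwarz_abs[of \<rho> \<phi>] by simp
qed

text \<open>In \<kappa> the share 3 / g pays for the \<open>N\<close> steps and 1/4 for undoing the
  symmetrization.\<close>

lemma exponential_moment_le:
  fixes f :: "'s \<Rightarrow> real ^ 'm::finite"
  assumes chain: "markov_chain M X P \<mu>0"
    and g: "0 < g" "g \<le> 1"
    and gap: "\<And>\<phi>. ip \<phi> (Pop \<phi>) \<le> (1 - g) * ip \<phi> \<phi> + g * (ip (\<lambda>_. 1) \<phi>)\<^sup>2"
    and mean: "measure_pmf.expectation \<mu> f = 0"
    and L: "\<And>s. norm (f s) \<le> L"
    and N: "N \<ge> 1"
    and \<kappa>: "1 / 4 + 3 / g \<le> \<kappa>"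
  shows "(\<Sum>x\<in>PiE {..N} (\<lambda>_. UNIV). path_prob M X N x * exp (u \<bullet> (\<Sum>t=1..N. f (x t))))
    \<le> 3 * density_norm \<mu>0 \<mu> * exp (\<kappa> * L\<^sup>2 * real N * (norm u)\<^sup>2)"
proof -
  define h where "h = (\<lambda>s. u \<bullet> f s)"
  define b where "b = norm u * L"
  have h: "\<bar>h s\<bar> \<le> b" for s
    using order_trans[OF Cauchy_Schwarz_ineq2 mult_left_mono[OF L[of s] norm_ge_zero[of u]]]
    by (simp add: h_def b_def)
  have "ip (\<lambda>_. 1) h = u \<bullet> (\<Sum>s\<in>UNIV. pmf \<mu> s *\<^sub>R f s)"
    by (simp add: ip_def h_def inner_sum_right)
  also have "(\<Sum>s\<in>UNIV. pmf \<mu> s *\<^sub>R f s) = 0"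
    using mean by (subst (asm) integral_measure_pmf[of UNIV]) auto
  finally have h1: "ip (\<lambda>_. 1) h = 0" by simp
  define F where "F = (weighted_step h ^^ N) (\<lambda>_. 1)"
  have "(\<Sum>x\<in>PiE {..N} (\<lambda>_. UNIV). path_prob M X N x * exp (u \<bullet> (\<Sum>t=1..N. f (x t))))
      = (\<Sum>s\<in>UNIV. pmf \<mu>0 s * F s)"
    using sum_paths_weighted[OF chain, of N h "\<lambda>_. 1"] by (simp add: F_def h_def inner_sum_right)
  also have "\<dots> \<le> density_norm \<mu>0 \<mu> * sqrt (ip F F)" by (rule sum_initial_le)
  also have "\<dots> \<le> density_norm \<mu>0 \<mu> * (3 * exp (\<kappa> * L\<^sup>2 * real N * (norm u)\<^sup>2))"
  proof (rule mult_left_mono)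
    have "sqrt (ip F F) \<le> exp (b + 3 * b\<^sup>2 / g * real N)"
      unfolding F_def by (rule weighted_step_funpow_bound[OF g gap h h1])
    also have "\<dots> \<le> exp (1 + \<kappa> * b\<^sup>2 * real N)"
    \<comment> \<open>Undoing the symmetrization costs \<open>exp b \<le> exp (1 + b\<^sup>2 / 4)\<close>; the first factor becomes the constant 3.\<close>
    proof -
      have "0 \<le> (b / 2 - 1)\<^sup>2" by simp
      hence "b \<le> 1 + b\<^sup>2 / 4 * 1" by (simp add: power2_eq_square algebra_simps)
      also have "b\<^sup>2 / 4 * 1 \<le> b\<^sup>2 / 4 * real N" using N by (intro mult_left_mono) auto
      finally have "b + 3 * b\<^sup>2 / g * real N \<le> 1 + (1 / 4 + 3 / g) * (b\<^sup>2 * real N)"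
        by (simp add: algebra_simps)
      also have "(1 / 4 + 3 / g) * (b\<^sup>2 * real N) \<le> \<kappa> * (b\<^sup>2 * real N)"
        by (rule mult_right_mono[OF \<kappa>]) simp
      finally show ?thesis by (simp add: mult_ac)
    qed
    also have "\<dots> = exp 1 * exp (\<kappa> * L\<^sup>2 * real N * (norm u)\<^sup>2)"
      by (simp add: mult_exp_exp b_def power_mult_distrib mult_ac)
    also have "\<dots> \<le> 3 * exp (\<kappa> * L\<^sup>2 * real N * (norm u)\<^sup>2)"
      by (intro mult_right_mono exp_le) simp
    finally show "sqrt (ip F F) \<le> 3 * exp (\<kappa> * L\<^sup>2 * real N * (norm u)\<^sup>2)" .
    show "density_norm \<mu>0 \<mu> \<ge> 0" by (simp add: density_norm_def)
  qed
  finally show ?thesis by (simp only: mult_ac)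
qed

lemma tail_bound:
  fixes f :: "'s \<Rightarrow> real ^ 'm::finite"
  assumes chain: "markov_chain M X P \<mu>0"
    and "0 < g" "g \<le> 1"
    and "\<And>\<phi>. ip \<phi> (Pop \<phi>) \<le> (1 - g) * ip \<phi> \<phi> + g * (ip (\<lambda>_. 1) \<phi>)\<^sup>2"
    and "measure_pmf.expectation \<mu> f = 0"
    and L: "\<And>s. norm (f s) \<le> L" "L > 0"
    and N: "N \<ge> 1"
    and \<kappa>: "1 / 4 + 3 / g \<le> \<kappa>"
    and a: "a \<ge> 0"
  shows "measure M {\<omega>\<in>space M. norm (\<Sum>t=1..N. f (X t \<omega>)) \<ge> a}
    \<le> 3 * density_norm \<mu>0 \<mu> * sqrt 2 ^ CARD('m) * exp (- (a\<^sup>2 / (8 * (\<kappa> * L\<^sup>2 * real N))))"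
proof -
  define K where "K = \<kappa> * L\<^sup>2 * real N"
  define Z where "Z x = (\<Sum>t=1..N. f (x t))" for x
  define \<Omega> where "\<Omega> = PiE {..N} (\<lambda>_. UNIV :: 's set)"
  have fin: "finite \<Omega>" by (simp add: \<Omega>_def finite_PiE)
  have pnn: "path_prob M X N x \<ge> 0" for x by (simp add: path_prob_def)
  have "0 < 1 / 4 + 3 / g" using assms(2) by (simp add: add_pos_pos)
  hence K: "K > 0" using \<kappa> L(2) N unfolding K_def by (intro mult_pos_pos) auto
  have "measure M {\<omega>\<in>space M. norm (\<Sum>t=1..N. f (X t \<omega>)) \<ge> a} \<le> (\<Sum>x\<in>{x\<in>\<Omega>. a \<le> norm (Z x)}. path_prob M X N x)"
  proof (rule measure_le_sum_path_prob)
    show "prob_space M" "\<And>t. X t \<in> measurable M (count_space UNIV)"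
      using chain by (auto simp: markov_chain_def)
    fix \<omega> assume "a \<le> norm (\<Sum>t=1..N. f (X t \<omega>))"
    moreover have "Z (restrict (\<lambda>t. X t \<omega>) {..N}) = (\<Sum>t=1..N. f (X t \<omega>))"
      unfolding Z_def by (intro sum.cong) auto
    ultimately show "restrict (\<lambda>t. X t \<omega>) {..N} \<in> {x\<in>\<Omega>. a \<le> norm (Z x)}" by (simp add: \<Omega>_def)
  qed (auto simp: \<Omega>_def)
  \<comment> \<open>Markov's inequality for exp (|Z|^2 / (8 K)), path by path.\<close>
  also have "\<dots> \<le> (\<Sum>x\<in>{x\<in>\<Omega>. a \<le> norm (Z x)}. exp (- (a\<^sup>2 / (8 * K))) * (path_prob M X N x * exp ((norm (Z x))\<^sup>2 / (8 * K))))"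
  proof (rule sum_mono)
    fix x assume "x \<in> {x\<in>\<Omega>. a \<le> norm (Z x)}"
    hence "a\<^sup>2 / (8 * K) \<le> (norm (Z x))\<^sup>2 / (8 * K)"
      using a K by (intro divide_right_mono power_mono) auto
    hence "path_prob M X N x * 1 \<le> path_prob M X N x * (exp (- (a\<^sup>2 / (8 * K))) * exp ((norm (Z x))\<^sup>2 / (8 * K)))"
      unfolding mult_exp_exp by (intro mult_left_mono pnn) simp
    thus "path_prob M X N x \<le> exp (- (a\<^sup>2 / (8 * K))) * (path_prob M X N x * exp ((norm (Z x))\<^sup>2 / (8 * K)))"
      by (simp add: mult_ac)
  qed
  also have "\<dots> \<le> (\<Sum>x\<in>\<Omega>. exp (- (a\<^sup>2 / (8 * K))) * (path_prob M X N x * exp ((norm (Z x))\<^sup>2 / (8 * K))))"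
    using fin pnn by (intro sum_mono2) auto
  also have "\<dots> \<le> exp (- (a\<^sup>2 / (8 * K))) * (sqrt 2 ^ CARD('m) * (3 * density_norm \<mu>0 \<mu>))"
    unfolding sum_distrib_left[symmetric]
    by (intro mult_left_mono sum_exp_norm_square_le fin pnn K)
       (use exponential_moment_le[OF assms(1-6) N \<kappa>] in \<open>simp_all add: \<Omega>_def Z_def K_def\<close>)
  finally show ?thesis by (simp only: K_def mult_ac)
qed

text \<open>Lowering a gap above 1 to 1 weakens the inequality, because the squared mean is at most
  the mean square.\<close>

lemma contraction_gap_form:
  assumes card: "CARD('s) \<ge> 2"
  shows "ip \<phi> (Pop \<phi>) \<le> (1 - min (spectral_gap P) 1) * ip \<phi> \<phi> + min (spectral_gap P) 1 * (ip (\<lambda>_. 1) \<phi>)\<^sup>2"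
proof (cases "spectral_gap P \<le> 1")
  case True
  thus ?thesis using spectral_gap_form(2)[OF card, of \<phi>] by simp
next
  case False
  have "(ip (\<lambda>_. 1) \<phi>)\<^sup>2 \<le> ip \<phi> \<phi>" using ip_Cauchy_Schwarz[of "\<lambda>_. 1" \<phi>] by (simp add: ip_1_1)
  hence "(spectral_gap P - 1) * (ip (\<lambda>_. 1) \<phi>)\<^sup>2 \<le> (spectral_gap P - 1) * ip \<phi> \<phi>"
    using False by (intro mult_left_mono) auto
  thus ?thesis using spectral_gap_form(2)[OF card, of \<phi>] False by (simp add: algebra_simps)
qed

end

text \<open>The right side is 1 / (8 \<alpha>). Since ln (1 + x) <= x, its last term is at least 768
  / (125 g), about 6.1 / g. For g <= 1 this beats 3 / g; for g > 1 the left side is 13/4, and g <= 2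
  keeps the right side above it.\<close>

lemma rate_constant_ge:
  fixes g :: real
  assumes "0 < g" "g \<le> 2"
  shows "1 / 4 + 3 / min g 1 \<le> 1 / 2 + 1 / g + 192 / 125 * (g / (ln (1 + g / 2))\<^sup>2)"
proof -
  have l: "0 < ln (1 + g / 2)" "ln (1 + g / 2) \<le> g / 2"
    using assms ln_add_one_self_le_self[of "g / 2"] by simp_all
  have "(ln (1 + g / 2))\<^sup>2 \<le> (g / 2)\<^sup>2" using l by (intro power_mono) auto
  hence "g / (g / 2)\<^sup>2 \<le> g / (ln (1 + g / 2))\<^sup>2" using l assms by (intro divide_left_mono) auto
  moreover have "g / (g / 2)\<^sup>2 = 4 / g" using assms(1) by (simp add: field_simps power2_eq_square)
  ultimately have "4 / g \<le> g / (ln (1 + g / 2))\<^sup>2" by simp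
  moreover have "1 / 4 + 3 / min g 1 \<le> 1 / 2 + 1 / g + 192 / 125 * (4 / g)"
  proof (cases "g \<le> 1")
    case True
    thus ?thesis using assms(1) by (simp add: field_simps)
  next
    case False
    thus ?thesis using assms by (simp add: field_simps)
  qed
  ultimately show ?thesis by linarith
qed

theorem corollary2:
  fixes P :: "real ^ 's ^ 's::finite"
    and \<mu> \<mu>0 :: "'s pmf"
    and f :: "'s \<Rightarrow> real ^ 'm::finite"
    and M :: "'w measure"
    and X :: "nat \<Rightarrow> 'w \<Rightarrow> 's"
    and g L \<sigma>2 \<epsilon> \<alpha> :: real
    and N :: nat
  assumes "CARD('s) \<ge> 2"
    and "stochastic_matrix P"
    and "invariant_distribution P \<mu>"
    and "\<And>s. pmf \<mu> s > 0"
    and "markov_chain M X P \<mu>0"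
    and "reversible P \<mu>"
    and "eigenvalue_list P ! 1 < 1"
    and "g = spectral_gap P"
    and "measure_pmf.expectation \<mu> f = 0"
    and "L > 0"
    and "sup_norm f \<le> L"
    and "principal_variance \<mu> f \<le> \<sigma>2"
    and "\<epsilon> > 0"
    and "N \<ge> 1"
    and "\<alpha> = inverse (4 + 8 / g + 1536 / 125 * (g / (ln (1 + g / 2))\<^sup>2))"
  shows "measure M {\<omega>\<in>space M. norm (\<Sum>t=1..N. f (X t \<omega>)) \<ge> \<epsilon> * real N}
    \<le> 3 * density_norm \<mu>0 \<mu> * 2 powr (real CARD('m) / 2) * exp (- \<alpha> * (\<epsilon>\<^sup>2 / L\<^sup>2) * real N)"
proof -
  interpret reversible_chain P \<mu> using assms by unfold_locales
  define \<kappa> where "\<kappa> = 1 / 2 + 1 / g + 192 / 125 * (g / (ln (1 + g / 2))\<^sup>2)"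
  have g: "0 < g" "g \<le> 2"
    using assms(7) spectral_gap_form(1)[OF assms(1)] by (simp_all add: assms(8) spectral_gap_def)
  have fL: "norm (f s) \<le> L" for s
  proof -
    have "norm (f s) \<le> sup_norm f" unfolding sup_norm_def by (rule cSUP_upper) auto
    thus ?thesis using assms(11) by simp
  qed
  have "\<alpha> = 1 / (8 * \<kappa>)" unfolding assms(15) \<kappa>_def by (simp add: inverse_eq_divide algebra_simps)
  hence e: "(\<epsilon> * real N)\<^sup>2 / (8 * (\<kappa> * L\<^sup>2 * real N)) = \<alpha> * (\<epsilon>\<^sup>2 / L\<^sup>2) * real N"
    using assms(14) by (simp add: power2_eq_square)
  have p: "sqrt 2 ^ CARD('m) = 2 powr (real CARD('m) / 2)"
    by (simp add: powr_half_sqrt[symmetric] powr_powr flip: powr_realpow)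
  have "0 < min (spectral_gap P) 1" "min (spectral_gap P) 1 \<le> 1"
    using g by (simp_all add: assms(8))
  from tail_bound[OF assms(5) this contraction_gap_form[OF assms(1)] assms(9) fL assms(10,14), of \<kappa> "\<epsilon> * real N"]
  have "measure M {\<omega>\<in>space M. norm (\<Sum>t=1..N. f (X t \<omega>)) \<ge> \<epsilon> * real N}
      \<le> 3 * density_norm \<mu>0 \<mu> * sqrt 2 ^ CARD('m) * exp (- ((\<epsilon> * real N)\<^sup>2 / (8 * (\<kappa> * L\<^sup>2 * real N))))"
    using rate_constant_ge[OF g] assms(13) by (simp add: \<kappa>_def assms(8))
  thus ?thesis unfolding e p by simp
qed

end
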